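(* Let $\Omega\subset\mathbb{R}^d$ be a bounded domain, $V$ a real-valued bounded measurable potential, and $H=-\Delta+V(\mathbf{x})$ a self-adjoint operator on $L^2(\Omega)$ with domain $\mathcal{D}_H$ and purely discrete spectrum, with eigenvalues $\lambda_j$ and corresponding orthonormal basis of eigenfunctions $\{\phi_j\}$. Let $\mathbf{q}\in\mathbb{R}^d$ be such that multiplication by $e^{-i\mathbf{q}\cdot\mathbf{x}}$ and multiplication by $e^{i\mathbf{q}\cdot\mathbf{x}}$ both map $\mathcal{D}_H$ into $\mathcal{D}_H$. Define $$w_{kj\mathbf{q}}:=\tfrac12\left(|\langle e^{-i\mathbf{q}\cdot\mathbf{x}}\phi_j,\phi_k\rangle|^2+|\langle e^{i\mathbf{q}\cdot\mathbf{x}}\phi_j,\phi_k\rangle|^2\right).$$ Then the quantities $w_{kj\mathbf{q}}$ compose an infinite doubly stochastic matrix, i.e. (a) $\sum_k w_{kj\mathbf{q}}=\sum_j w_{kj\mathbf{q}}=1$, with the symmetries (b) $0\le w_{kj\mathbf{q}}=w_{jk\mathbf{q}}$, and (c) $w_{kj(-\mathbf{q})}=w_{kj\mathbf{q}}$. Moreover, for each $j$, $$\sum_k(\lambda_k-\lambda_j)\,w_{kj\mathbf{q}}=|\mathbf{q}|^2,\qquad\text{and in particular}\qquad \lambda_j=\sum_k\lambda_k\,w_{kj\mathbf{q}}-|\mathbf{q}|^2,$$ and $$\sum_k(\lambda_k-\lambda_j)^2\,w_{kj\mathbf{q}}=|\mathbf{q}|^4+4\|\mathbf{q}\cdot\n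abla\phi_j\|^2.$$
   Context: The inner product and norm are those of $L^2(\Omega)$. $H$ acts on its domain as the differential expression $-\Delta+V$, with boundary conditions on $\Omega$ for which $H$ is self-adjoint and the stated domain-mapping property holds. Examples are periodic boundary conditions on a fundamental domain with $\mathbf{q}$ in the reciprocal lattice, and Dirichlet conditions with arbitrary $\mathbf{q}$. *)

theory Defs
  imports "HOL-Analysis.Analysis"
begin

section \<open>The space of square-integrable functions on a domain\<close>

text \<open>
  Elements of the Hilbert space are represented by functions on the whole space, whose values
  outside \<open>\<Omega>\<close> are irrelevant, and equality in the Hilbert space is \<open>ae_eq \<Omega>\<close>.
\<close>

definition bounded_domain :: "(real^'d) set \<Rightarrow> bool" where
  "bounded_domain \<Omega> \<longleftrightarrow> open \<Omega> \<and> connected \<Omega> \<and> \<Omega> \<noteq> {} \<and> bounded \<Omega>"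

definition L2 :: "(real^'d) set \<Rightarrow> (real^'d \<Rightarrow> complex) set" where
  "L2 \<Omega> = {f. f \<in> borel_measurable (lebesgue_on \<Omega>) \<and>
              integrable (lebesgue_on \<Omega>) (\<lambda>x. (cmod (f x))\<^sup>2)}"

definition ae_eq :: "(real^'d) set \<Rightarrow> (real^'d \<Rightarrow> complex) \<Rightarrow> (real^'d \<Rightarrow> complex) \<Rightarrow> bool" where
  "ae_eq \<Omega> f g \<longleftrightarrow> (AE x in lebesgue_on \<Omega>. f x = g x)"

definition L2_inner :: "(real^'d) set \<Rightarrow> (real^'d \<Rightarrow> complex) \<Rightarrow> (real^'d \<Rightarrow> complex) \<Rightarrow> complex" where
  "L2_inner \<Omega> f g = (LINT x|lebesgue_on \<Omega>. f x * cnj (g x))"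

definition L2_norm :: "(real^'d) set \<Rightarrow> (real^'d \<Rightarrow> complex) \<Rightarrow> real" where
  "L2_norm \<Omega> f = sqrt (LINT x|lebesgue_on \<Omega>. (cmod (f x))\<^sup>2)"

definition L2_dense :: "(real^'d) set \<Rightarrow> (real^'d \<Rightarrow> complex) set \<Rightarrow> bool" where
  "L2_dense \<Omega> D \<longleftrightarrow> (\<forall>f\<in>L2 \<Omega>. \<forall>e>0. \<exists>g\<in>D. L2_norm \<Omega> (\<lambda>x. f x - g x) < e)"

definition finite_combinations :: "(nat \<Rightarrow> real^'d \<Rightarrow> complex) \<Rightarrow> (real^'d \<Rightarrow> complex) set" where
  "finite_combinations \<phi> = {\<lambda>x. \<Sum>k<n. c k * \<phi> k x | n c. True}"

definition orthonormal_basis :: "(real^'d) set \<Rightarrow> (nat \<Rightarrow> real^'d \<Rightarrow> complex) \<Rightarrow> bool" where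
  "orthonormal_basis \<Omega> \<phi> \<longleftrightarrow>
     (\<forall>j. \<phi> j \<in> L2 \<Omega>) \<and>
     (\<forall>j k. L2_inner \<Omega> (\<phi> j) (\<phi> k) = (if j = k then 1 else 0)) \<and>
     L2_dense \<Omega> (finite_combinations \<phi>)"

section \<open>Unbounded operators\<close>

text \<open>
  An operator is given by its domain \<open>D\<close> and a map \<open>H\<close> whose values outside \<open>D\<close> are irrelevant.
\<close>

definition linear_operator ::
  "(real^'d) set \<Rightarrow> (real^'d \<Rightarrow> complex) set \<Rightarrow> ((real^'d \<Rightarrow> complex) \<Rightarrow> (real^'d \<Rightarrow> complex)) \<Rightarrow> bool" where
  "linear_operator \<Omega> D H \<longleftrightarrow>
     D \<subseteq> L2 \<Omega> \<and> H ` D \<subseteq> L2 \<Omega> \<and>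
     (\<forall>f\<in>D. \<forall>g\<in>L2 \<Omega>. ae_eq \<Omega> f g \<longrightarrow> g \<in> D \<and> ae_eq \<Omega> (H f) (H g)) \<and>
     (\<lambda>x. 0) \<in> D \<and>
     (\<forall>f\<in>D. \<forall>g\<in>D. \<forall>a b. (\<lambda>x. a * f x + b * g x) \<in> D \<and>
        ae_eq \<Omega> (H (\<lambda>x. a * f x + b * g x)) (\<lambda>x. a * H f x + b * H g x))"

definition operator_graph ::
  "(real^'d) set \<Rightarrow> (real^'d \<Rightarrow> complex) set \<Rightarrow> ((real^'d \<Rightarrow> complex) \<Rightarrow> (real^'d \<Rightarrow> complex))
     \<Rightarrow> ((real^'d \<Rightarrow> complex) \<times> (real^'d \<Rightarrow> complex)) set" where
  "operator_graph \<Omega> D H = {(g, h). g \<in> D \<and> h \<in> L2 \<Omega> \<and> ae_eq \<Omega> h (H g)}"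

definition adjoint_graph ::
  "(real^'d) set \<Rightarrow> (real^'d \<Rightarrow> complex) set \<Rightarrow> ((real^'d \<Rightarrow> complex) \<Rightarrow> (real^'d \<Rightarrow> complex))
     \<Rightarrow> ((real^'d \<Rightarrow> complex) \<times> (real^'d \<Rightarrow> complex)) set" where
  "adjoint_graph \<Omega> D H = {(g, h). g \<in> L2 \<Omega> \<and> h \<in> L2 \<Omega> \<and>
     (\<forall>f\<in>D. L2_inner \<Omega> (H f) g = L2_inner \<Omega> f h)}"

definition self_adjoint_operator ::
  "(real^'d) set \<Rightarrow> (real^'d \<Rightarrow> complex) set \<Rightarrow> ((real^'d \<Rightarrow> complex) \<Rightarrow> (real^'d \<Rightarrow> complex)) \<Rightarrow> bool" where
  "self_adjoint_operator \<Omega> D H \<longleftrightarrow>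
     linear_operator \<Omega> D H \<and> L2_dense \<Omega> D \<and> adjoint_graph \<Omega> D H = operator_graph \<Omega> D H"

text \<open>Below, \<open>C\<close> bounds the inverse of the bijection \<open>H - z\<close> from \<open>D\<close> onto \<open>L2 \<Omega>\<close> (modulo \<open>ae_eq \<Omega>\<close>).\<close>

definition resolvent_set ::
  "(real^'d) set \<Rightarrow> (real^'d \<Rightarrow> complex) set \<Rightarrow> ((real^'d \<Rightarrow> complex) \<Rightarrow> (real^'d \<Rightarrow> complex)) \<Rightarrow> complex set" where
  "resolvent_set \<Omega> D H = {z. \<exists>C. \<forall>g\<in>L2 \<Omega>. \<exists>f\<in>D.
     ae_eq \<Omega> (\<lambda>x. H f x - z * f x) g \<and> L2_norm \<Omega> f \<le> C * L2_norm \<Omega> g \<and>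
     (\<forall>f'\<in>D. ae_eq \<Omega> (\<lambda>x. H f' x - z * f' x) g \<longrightarrow> ae_eq \<Omega> f' f)}"

definition op_spectrum ::
  "(real^'d) set \<Rightarrow> (real^'d \<Rightarrow> complex) set \<Rightarrow> ((real^'d \<Rightarrow> complex) \<Rightarrow> (real^'d \<Rightarrow> complex)) \<Rightarrow> complex set" where
  "op_spectrum \<Omega> D H = - resolvent_set \<Omega> D H"

definition eigenspace ::
  "(real^'d) set \<Rightarrow> (real^'d \<Rightarrow> complex) set \<Rightarrow> ((real^'d \<Rightarrow> complex) \<Rightarrow> (real^'d \<Rightarrow> complex))
     \<Rightarrow> complex \<Rightarrow> (real^'d \<Rightarrow> complex) set" where
  "eigenspace \<Omega> D H z = {f\<in>D. ae_eq \<Omega> (H f) (\<lambda>x. z * f x)}"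

definition purely_discrete_spectrum ::
  "(real^'d) set \<Rightarrow> (real^'d \<Rightarrow> complex) set \<Rightarrow> ((real^'d \<Rightarrow> complex) \<Rightarrow> (real^'d \<Rightarrow> complex)) \<Rightarrow> bool" where
  "purely_discrete_spectrum \<Omega> D H \<longleftrightarrow>
     (\<forall>z\<in>op_spectrum \<Omega> D H.
        z isolated_in op_spectrum \<Omega> D H \<and>
        (\<exists>f\<in>eigenspace \<Omega> D H z. \<not> ae_eq \<Omega> f (\<lambda>x. 0)) \<and>
        (\<exists>B. finite B \<and> B \<subseteq> eigenspace \<Omega> D H z \<and>
          (\<forall>f\<in>eigenspace \<Omega> D H z. \<exists>c. ae_eq \<Omega> f (\<lambda>x. \<Sum>b\<in>B. c b * b x))))"

section \<open>Distributions and the differential expression\<close>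

definition pderiv_at :: "'d \<Rightarrow> (real^'d \<Rightarrow> complex) \<Rightarrow> (real^'d \<Rightarrow> complex)" where
  "pderiv_at i f = (\<lambda>x. frechet_derivative f (at x) (axis i 1))"

primrec Ck :: "nat \<Rightarrow> (real^'d \<Rightarrow> complex) \<Rightarrow> bool" where
  "Ck 0 f \<longleftrightarrow> continuous_on UNIV f"
| "Ck (Suc n) f \<longleftrightarrow> (\<forall>x. f differentiable (at x)) \<and> (\<forall>i. Ck n (pderiv_at i f))"

definition test_function :: "(real^'d) set \<Rightarrow> (real^'d \<Rightarrow> complex) \<Rightarrow> bool" where
  "test_function \<Omega> \<psi> \<longleftrightarrow> (\<forall>n. Ck n \<psi>) \<and>
     compact (closure {x. \<psi> x \<noteq> 0}) \<and> closure {x. \<psi> x \<noteq> 0} \<subseteq> \<Omega>"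

text \<open>
  Distributions are functionals on test functions, with the bilinear pairing
  (no conjugation) and derivatives defined by duality.
\<close>

type_synonym 'd distr = "(real^'d \<Rightarrow> complex) \<Rightarrow> complex"

definition distr_of :: "(real^'d) set \<Rightarrow> (real^'d \<Rightarrow> complex) \<Rightarrow> 'd distr" where
  "distr_of \<Omega> f = (\<lambda>\<psi>. LINT x|lebesgue_on \<Omega>. f x * \<psi> x)"

definition distr_pderiv :: "'d::finite \<Rightarrow> 'd distr \<Rightarrow> 'd distr" where
  "distr_pderiv i T = (\<lambda>\<psi>. - T (pderiv_at i \<psi>))"

definition distr_laplacian :: "'d::finite distr \<Rightarrow> 'd distr" where
  "distr_laplacian T = (\<lambda>\<psi>. \<Sum>i\<in>UNIV. distr_pderiv i (distr_pderiv i T) \<psi>)"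

definition distr_dot_grad :: "real^'d \<Rightarrow> 'd::finite distr \<Rightarrow> 'd distr" where
  "distr_dot_grad q T = (\<lambda>\<psi>. \<Sum>i\<in>UNIV. of_real (q $ i) * distr_pderiv i T \<psi>)"

definition distr_eq :: "(real^'d) set \<Rightarrow> 'd distr \<Rightarrow> 'd distr \<Rightarrow> bool" where
  "distr_eq \<Omega> S T \<longleftrightarrow> (\<forall>\<psi>. test_function \<Omega> \<psi> \<longrightarrow> S \<psi> = T \<psi>)"

text \<open>
  On its domain \<open>H\<close> acts as the differential expression \<open>-\<Delta> + V\<close>, in the sense of distributions
  on \<open>\<Omega>\<close>.  The boundary conditions enter only through the choice of \<open>D\<close>.
\<close>

definition acts_as_schroedinger ::
  "(real^'d) set \<Rightarrow> (real^'d \<Rightarrow> real) \<Rightarrow> (real^'d \<Rightarrow> complex) set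
     \<Rightarrow> ((real^'d \<Rightarrow> complex) \<Rightarrow> (real^'d \<Rightarrow> complex)) \<Rightarrow> bool" where
  "acts_as_schroedinger \<Omega> V D H \<longleftrightarrow>
     (\<forall>f\<in>D. distr_eq \<Omega> (distr_of \<Omega> (H f))
        (\<lambda>\<psi>. - distr_laplacian (distr_of \<Omega> f) \<psi> + distr_of \<Omega> (\<lambda>x. of_real (V x) * f x) \<psi>))"

section \<open>The weights\<close>

definition plane_wave_mult :: "real^'d \<Rightarrow> (real^'d \<Rightarrow> complex) \<Rightarrow> (real^'d \<Rightarrow> complex)" where
  "plane_wave_mult q f = (\<lambda>x. exp (\<i> * of_real (q \<bullet> x)) * f x)"

definition weight ::
  "(real^'d) set \<Rightarrow> (nat \<Rightarrow> real^'d \<Rightarrow> complex) \<Rightarrow> nat \<Rightarrow> nat \<Rightarrow> real^'d \<Rightarrow> real" where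
  "weight \<Omega> \<phi> k j q = 1 / 2 *
     ((cmod (L2_inner \<Omega> (plane_wave_mult (- q) (\<phi> j)) (\<phi> k)))\<^sup>2 +
      (cmod (L2_inner \<Omega> (plane_wave_mult q (\<phi> j)) (\<phi> k)))\<^sup>2)"

end

theory Submission
  imports Defs
begin

text \<open>
  Write \<open>e\<^sub>p\<close> for multiplication by \<open>exp (\<i> p \<bullet> x)\<close>.  It is unitary with inverse \<open>e\<^sub>-\<^sub>p\<close>, so the rows of the
  weight matrix sum to 1 by Parseval's identity (\<open>parseval\<close>), and moving \<open>e\<^sub>p\<close> to the other side of
  the inner product gives the symmetry in \<open>j\<close> and \<open>k\<close>, hence the column sums.

  The moments come from conjugating the operator:
  \<open>e\<^sub>-\<^sub>p H e\<^sub>p f = H f + |p|\<^sup>2 f - 2 \<i> p \<bullet> \<nabla>f\<close>.  Both \<open>f\<close> and \<open>e\<^sub>p f\<close> lie in the domain, so \<open>H f\<close> and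
  \<open>H (e\<^sub>p f)\<close> are square integrable, and the identity itself forces the distribution \<open>p \<bullet> \<nabla>f\<close> to be a
  square-integrable function (\<open>twisted_gradient_distr\<close>).  For an eigenfunction \<open>\<phi>\<^sub>j\<close> and \<open>g = p \<bullet> \<nabla>\<phi>\<^sub>j\<close>, symmetry of \<open>H\<close> then gives
  \<open>(\<lambda>\<^sub>k - \<lambda>\<^sub>j) \<langle>e\<^sub>p \<phi>\<^sub>j, \<phi>\<^sub>k\<rangle> = \<langle>e\<^sub>p (|p|\<^sup>2 \<phi>\<^sub>j - 2 \<i> g), \<phi>\<^sub>k\<rangle>\<close>,
  and Parseval's identity turns the sums over \<open>k\<close> into the inner product of \<open>|p|\<^sup>2 \<phi>\<^sub>j - 2 \<i> g\<close> with \<open>\<phi>\<^sub>j\<close>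
  and into its squared norm (\<open>plane_wave_spectral_moments\<close>).  Each result has one cross term that is
  odd in \<open>g\<close>, a multiple of \<open>Im \<langle>g, \<phi>\<^sub>j\<rangle>\<close>.  The weights average \<open>p = q\<close> and \<open>p = -q\<close>, for which \<open>g\<close> has
  opposite signs, so that the cross terms cancel although the eigenfunctions may be complex.

  The sign change of \<open>g\<close> holds at first only for distributions.  That it holds almost everywhere
  (\<open>twisted_gradient_minus\<close>) is the fundamental lemma of the calculus of variations
  (\<open>test_functions_separate\<close>), which rests on an explicit supply of smooth bumps.
\<close>

section \<open>The space of square-integrable functions\<close>

lemma cmod_add_squared_le: "(cmod (a + b))\<^sup>2 \<le> 2 * (cmod a)\<^sup>2 + 2 * (cmod b)\<^sup>2"
proof -
  have "(cmod (a + b))\<^sup>2 \<le> (cmod a + cmod b)\<^sup>2"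
    by (intro power_mono norm_triangle_ineq) auto
  also have "\<dots> \<le> 2 * (cmod a)\<^sup>2 + 2 * (cmod b)\<^sup>2"
    using sum_squares_ge_zero[of "cmod a - cmod b" 0] by (simp add: power2_eq_square algebra_simps)
  finally show ?thesis .
qed

lemma L2_times_integrable:
  assumes "f \<in> L2 \<Omega>" "g \<in> L2 \<Omega>"
  shows "integrable (lebesgue_on \<Omega>) (\<lambda>x. f x * g x)"
proof (rule Bochner_Integration.integrable_bound)
  show "integrable (lebesgue_on \<Omega>) (\<lambda>x. (cmod (f x))\<^sup>2 + (cmod (g x))\<^sup>2)"
    using assms unfolding L2_def by auto
  have "cmod a * cmod b \<le> (cmod a)\<^sup>2 + (cmod b)\<^sup>2" for a b
  proof -
    have "2 * (cmod a * cmod b) \<le> (cmod a)\<^sup>2 + (cmod b)\<^sup>2"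
      using sum_squares_bound[of "cmod a" "cmod b"] by simp
    then show ?thesis 
      using mult_nonneg_nonneg[OF norm_ge_zero norm_ge_zero, of a b] by linarith
  qed
  then show "AE x in lebesgue_on \<Omega>. norm (f x * g x) \<le> norm ((cmod (f x))\<^sup>2 + (cmod (g x))\<^sup>2)"
    by (auto simp: norm_mult)
qed (use assms in \<open>auto simp: L2_def\<close>)

lemma L2_lincomb:
  assumes "f \<in> L2 \<Omega>" "g \<in> L2 \<Omega>"
  shows "(\<lambda>x. a * f x + b * g x) \<in> L2 \<Omega>"
proof -
  have "integrable (lebesgue_on \<Omega>) (\<lambda>x. (cmod (a * f x + b * g x))\<^sup>2)"
  proof (rule Bochner_Integration.integrable_bound)
    show "integrable (lebesgue_on \<Omega>) (\<lambda>x. 2 * ((cmod a)\<^sup>2 * (cmod (f x))\<^sup>2) + 2 * ((cmod b)\<^sup>2 * (cmod (g x))\<^sup>2))"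
      using assms unfolding L2_def by auto
    show "AE x in lebesgue_on \<Omega>. norm ((cmod (a * f x + b * g x))\<^sup>2) \<le>
       norm (2 * ((cmod a)\<^sup>2 * (cmod (f x))\<^sup>2) + 2 * ((cmod b)\<^sup>2 * (cmod (g x))\<^sup>2))"
      using cmod_add_squared_le[of "a * f x" "b * g x" for x]
      by (auto simp: norm_mult power_mult_distrib)
  qed (use assms in \<open>auto simp: L2_def\<close>)
  then show ?thesis using assms by (auto simp: L2_def)
qed

lemma L2_scale: "f \<in> L2 \<Omega> \<Longrightarrow> (\<lambda>x. a * f x) \<in> L2 \<Omega>"
  using L2_lincomb[of f \<Omega> f a 0] by simp

lemma L2_add: "f \<in> L2 \<Omega> \<Longrightarrow> g \<in> L2 \<Omega> \<Longrightarrow> (\<lambda>x. f x + g x) \<in> L2 \<Omega>"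
  using L2_lincomb[of f \<Omega> g 1 1] by simp

lemma L2_diff: "f \<in> L2 \<Omega> \<Longrightarrow> g \<in> L2 \<Omega> \<Longrightarrow> (\<lambda>x. f x - g x) \<in> L2 \<Omega>"
  using L2_lincomb[of f \<Omega> g 1 "-1"] by simp

lemma L2_zero: "(\<lambda>x. 0) \<in> L2 \<Omega>"
  by (simp add: L2_def)

lemma L2_sum: "(\<And>k. k \<in> A \<Longrightarrow> f k \<in> L2 \<Omega>) \<Longrightarrow> (\<lambda>x. \<Sum>k\<in>A. f k x) \<in> L2 \<Omega>"
  by (induction A rule: infinite_finite_induct) (auto simp: L2_zero intro: L2_add)

lemma L2_cnj: "f \<in> L2 \<Omega> \<Longrightarrow> (\<lambda>x. cnj (f x)) \<in> L2 \<Omega>"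
  unfolding L2_def using borel_measurable_continuous_onI[of cnj]
  by (auto intro!: measurable_compose[of f _ borel cnj] continuous_intros)

lemma L2_inner_integrable:
  "f \<in> L2 \<Omega> \<Longrightarrow> g \<in> L2 \<Omega> \<Longrightarrow> integrable (lebesgue_on \<Omega>) (\<lambda>x. f x * cnj (g x))"
  by (intro L2_times_integrable L2_cnj)

lemma L2_bounded_mult:
  assumes "f \<in> L2 \<Omega>" "u \<in> borel_measurable (lebesgue_on \<Omega>)" "\<And>x. x \<in> \<Omega> \<Longrightarrow> cmod (u x) \<le> C"
  shows "(\<lambda>x. u x * f x) \<in> L2 \<Omega>"
proof -
  have "integrable (lebesgue_on \<Omega>) (\<lambda>x. (cmod (u x * f x))\<^sup>2)"
  proof (rule Bochner_Integration.integrable_bound)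
    show "integrable (lebesgue_on \<Omega>) (\<lambda>x. C\<^sup>2 * (cmod (f x))\<^sup>2)"
      using assms unfolding L2_def by auto
    show "AE x in lebesgue_on \<Omega>. norm ((cmod (u x * f x))\<^sup>2) \<le> norm (C\<^sup>2 * (cmod (f x))\<^sup>2)"
    proof (rule AE_I2)
      fix x assume "x \<in> space (lebesgue_on \<Omega>)"
      then have "cmod (u x) \<le> C" using assms(3) by simp
      then have "(cmod (u x))\<^sup>2 \<le> C\<^sup>2" by (intro power_mono) auto
      then have "(cmod (u x))\<^sup>2 * (cmod (f x))\<^sup>2 \<le> C\<^sup>2 * (cmod (f x))\<^sup>2" by (intro mult_right_mono) auto
      then show "norm ((cmod (u x * f x))\<^sup>2) \<le> norm (C\<^sup>2 * (cmod (f x))\<^sup>2)"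
        by (simp add: norm_mult power_mult_distrib)
    qed
  qed (use assms(1,2) in \<open>auto simp: L2_def\<close>)
  then show ?thesis using assms(1,2) by (auto simp: L2_def)
qed

lemma L2_const:
  assumes "bounded \<Omega>" "\<Omega> \<in> sets lebesgue"
  shows "(\<lambda>x. c) \<in> L2 \<Omega>"
proof -
  have "\<Omega> \<in> lmeasurable" using assms by (simp add: bounded_set_imp_lmeasurable)
  then show ?thesis
    unfolding L2_def by (simp add: finite_measure_lebesgue_on finite_measure.integrable_const)
qed

lemma L2_inner_lincomb_left:
  assumes "f \<in> L2 \<Omega>" "g \<in> L2 \<Omega>" "h \<in> L2 \<Omega>"
  shows "L2_inner \<Omega> (\<lambda>x. a * f x + b * g x) h = a * L2_inner \<Omega> f h + b * L2_inner \<Omega> g h"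
  using assms L2_inner_integrable[of _ \<Omega> h]
  by (simp add: L2_inner_def distrib_right mult.assoc)

lemma L2_inner_add_left:
  assumes "f \<in> L2 \<Omega>" "g \<in> L2 \<Omega>" "h \<in> L2 \<Omega>"
  shows "L2_inner \<Omega> (\<lambda>x. f x + g x) h = L2_inner \<Omega> f h + L2_inner \<Omega> g h"
  using L2_inner_lincomb_left[OF assms, of 1 1] by simp

lemma L2_inner_diff_left:
  assumes "f \<in> L2 \<Omega>" "g \<in> L2 \<Omega>" "h \<in> L2 \<Omega>"
  shows "L2_inner \<Omega> (\<lambda>x. f x - g x) h = L2_inner \<Omega> f h - L2_inner \<Omega> g h"
  using L2_inner_lincomb_left[OF assms, of 1 "-1"] by simp

lemma L2_inner_scale_left: "L2_inner \<Omega> (\<lambda>x. a * f x) h = a * L2_inner \<Omega> f h"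
  by (simp add: L2_inner_def mult.assoc)

lemma L2_inner_commute: "L2_inner \<Omega> g f = cnj (L2_inner \<Omega> f g)"
proof -
  have "cnj (L2_inner \<Omega> f g) = (LINT x|lebesgue_on \<Omega>. cnj (f x * cnj (g x)))"
    unfolding L2_inner_def by (simp only: Bochner_Integration.integral_cnj)
  then show ?thesis by (simp add: L2_inner_def mult.commute)
qed

lemma L2_inner_scale_right: "L2_inner \<Omega> f (\<lambda>x. a * h x) = cnj a * L2_inner \<Omega> f h"
  by (metis L2_inner_commute L2_inner_scale_left complex_cnj_mult)

lemma L2_inner_sum_left:
  assumes "\<And>k. k \<in> A \<Longrightarrow> f k \<in> L2 \<Omega>" "h \<in> L2 \<Omega>"
  shows "L2_inner \<Omega> (\<lambda>x. \<Sum>k\<in>A. f k x) h = (\<Sum>k\<in>A. L2_inner \<Omega> (f k) h)"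
  using assms L2_inner_integrable[of _ \<Omega> h]
  by (simp add: L2_inner_def sum_distrib_right Bochner_Integration.integral_sum)

lemma L2_norm_power2: "(L2_norm \<Omega> f)\<^sup>2 = Re (L2_inner \<Omega> f f)"
proof -
  have "L2_inner \<Omega> f f = (LINT x|lebesgue_on \<Omega>. complex_of_real ((cmod (f x))\<^sup>2))"
    unfolding L2_inner_def by (simp add: complex_norm_square del: of_real_power)
  also have "\<dots> = of_real (LINT x|lebesgue_on \<Omega>. (cmod (f x))\<^sup>2)"
    by (rule integral_complex_of_real)
  finally have "Re (L2_inner \<Omega> f f) = (LINT x|lebesgue_on \<Omega>. (cmod (f x))\<^sup>2)"
    by simp
  then show ?thesis unfolding L2_norm_def by simp
qed

lemma L2_norm_power2_lincomb:
  assumes "f \<in> L2 \<Omega>" "g \<in> L2 \<Omega>"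
  shows "(L2_norm \<Omega> (\<lambda>x. a * f x + b * g x))\<^sup>2 =
    (cmod a)\<^sup>2 * (L2_norm \<Omega> f)\<^sup>2 + (cmod b)\<^sup>2 * (L2_norm \<Omega> g)\<^sup>2
      + 2 * Re (a * cnj b * L2_inner \<Omega> f g)"
proof -
  let ?h = "\<lambda>x. a * f x + b * g x"
  have "?h \<in> L2 \<Omega>" using assms by (rule L2_lincomb)
  have "L2_inner \<Omega> ?h ?h = a * L2_inner \<Omega> f ?h + b * L2_inner \<Omega> g ?h"
    by (rule L2_inner_lincomb_left) fact+
  also have "\<dots> = a * cnj (L2_inner \<Omega> ?h f) + b * cnj (L2_inner \<Omega> ?h g)"
    by (simp only: L2_inner_commute[of _ f ?h] L2_inner_commute[of _ g ?h])
  also have "\<dots> = a * cnj a * cnj (L2_inner \<Omega> f f) + b * cnj b * cnj (L2_inner \<Omega> g g)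
      + (a * cnj b * L2_inner \<Omega> f g + cnj (a * cnj b * L2_inner \<Omega> f g))"
    using assms by (simp add: L2_inner_lincomb_left L2_inner_commute[of _ g f] algebra_simps)
  finally show ?thesis
    unfolding L2_norm_power2
    by (simp add: complex_norm_square[symmetric] algebra_simps del: of_real_power)
qed

lemma L2_inner_cong_ae:
  assumes "ae_eq \<Omega> f f'" "ae_eq \<Omega> g g'" "f \<in> L2 \<Omega>" "f' \<in> L2 \<Omega>" "g \<in> L2 \<Omega>" "g' \<in> L2 \<Omega>"
  shows "L2_inner \<Omega> f g = L2_inner \<Omega> f' g'"
  unfolding L2_inner_def
  by (rule integral_cong_AE)
    (use assms L2_inner_integrable[of f \<Omega> g] L2_inner_integrable[of f' \<Omega> g'] in \<open>auto simp: ae_eq_def\<close>)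

section \<open>Parseval's identity\<close>

text \<open>Completing the square in the coefficients: the Fourier coefficients give the best approximation,
  and the defect of any other choice is the last sum.\<close>
lemma orthonormal_sum_distance:
  fixes n :: nat
  assumes on: "\<And>j k. L2_inner \<Omega> (\<phi> j) (\<phi> k) = (if j = k then 1 else 0)"
    and \<phi>: "\<And>j. \<phi> j \<in> L2 \<Omega>" and h: "h \<in> L2 \<Omega>"
  shows "(L2_norm \<Omega> (\<lambda>x. h x - (\<Sum>k<n. c k * \<phi> k x)))\<^sup>2 =
    (L2_norm \<Omega> h)\<^sup>2 - (\<Sum>k<n. (cmod (L2_inner \<Omega> h (\<phi> k)))\<^sup>2)
      + (\<Sum>k<n. (cmod (c k - L2_inner \<Omega> h (\<phi> k)))\<^sup>2)"
proof -
  let ?s = "\<lambda>x. \<Sum>k<n. c k * \<phi> k x"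
  have s: "?s \<in> L2 \<Omega>" by (intro L2_sum L2_scale \<phi>)
  have sg: "L2_inner \<Omega> ?s g = (\<Sum>k<n. c k * L2_inner \<Omega> (\<phi> k) g)" if "g \<in> L2 \<Omega>" for g
    using that \<phi> by (subst L2_inner_sum_left) (auto intro: L2_scale simp: L2_inner_scale_left)
  have s\<phi>: "L2_inner \<Omega> ?s (\<phi> k) = c k" if "k < n" for k
  proof -
    have "(\<Sum>i<n. c i * (if i = k then 1 else 0)) = (\<Sum>i<n. if i = k then c i else 0)"
      by (intro sum.cong) auto
    also have "\<dots> = c k" using that by (simp add: sum.delta)
    finally show ?thesis by (simp add: sg \<phi> on)
  qed
  have "L2_inner \<Omega> ?s ?s = (\<Sum>k<n. c k * cnj (c k))"
    by (simp add: sg[OF s] L2_inner_commute[of _ "\<phi> _" ?s] s\<phi>)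
  then have ss: "(L2_norm \<Omega> ?s)\<^sup>2 = (\<Sum>k<n. (cmod (c k))\<^sup>2)"
    by (simp add: L2_norm_power2 complex_norm_square[symmetric] del: of_real_power)
  have "L2_inner \<Omega> h ?s = cnj (\<Sum>k<n. c k * L2_inner \<Omega> (\<phi> k) h)"
    by (simp add: L2_inner_commute[of _ h ?s] sg h)
  then have hs: "L2_inner \<Omega> h ?s = (\<Sum>k<n. cnj (c k) * L2_inner \<Omega> h (\<phi> k))"
    by (simp add: L2_inner_commute[of _ "\<phi> _" h])
  have square: "(cmod (a - b))\<^sup>2 = (cmod a)\<^sup>2 + (cmod b)\<^sup>2 - 2 * Re (cnj a * b)" for a b
    unfolding cmod_power2 by (simp add: power2_eq_square algebra_simps)
  have "(L2_norm \<Omega> (\<lambda>x. h x - ?s x))\<^sup>2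
      = (L2_norm \<Omega> h)\<^sup>2 + (L2_norm \<Omega> ?s)\<^sup>2 - 2 * Re (L2_inner \<Omega> h ?s)"
    using L2_norm_power2_lincomb[OF h s, of 1 "-1"] by simp
  moreover have "(\<Sum>k<n. (cmod (c k - L2_inner \<Omega> h (\<phi> k)))\<^sup>2) =
      (\<Sum>k<n. (cmod (c k))\<^sup>2) + (\<Sum>k<n. (cmod (L2_inner \<Omega> h (\<phi> k)))\<^sup>2) - 2 * Re (L2_inner \<Omega> h ?s)"
    unfolding hs square sum_subtractf sum.distrib Re_sum sum_distrib_left ..
  ultimately show ?thesis unfolding ss by linarith
qed

lemma mono_bounded_LIMSEQ:
  fixes X :: "nat \<Rightarrow> real"
  assumes "\<And>m n. m \<le> n \<Longrightarrow> X m \<le> X n" "\<And>n. X n \<le> L" "\<And>r. 0 < r \<Longrightarrow> \<exists>N. L - X N < r"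
  shows "X \<longlonglongrightarrow> L"
proof (rule LIMSEQ_I)
  fix r :: real assume "0 < r"
  then obtain N where N: "L - X N < r" using assms(3) by blast
  have "norm (X n - L) < r" if "N \<le> n" for n
    using assms(1)[OF that] assms(2)[of n] N by simp
  then show "\<exists>no. \<forall>n\<ge>no. norm (X n - L) < r" by blast
qed

text \<open>Any approximant from a dense set of finite combinations can only be improved by passing to the
  Fourier coefficients and by adding terms, so the partial sums in Bessel's inequality reach the norm.\<close>
lemma parseval:
  assumes "orthonormal_basis \<Omega> \<phi>" and h: "h \<in> L2 \<Omega>"
  shows "(\<lambda>k. (cmod (L2_inner \<Omega> h (\<phi> k)))\<^sup>2) sums (L2_norm \<Omega> h)\<^sup>2"
proof -
  let ?S = "\<lambda>n. \<Sum>k<n. (cmod (L2_inner \<Omega> h (\<phi> k)))\<^sup>2"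
  have on: "\<And>j k. L2_inner \<Omega> (\<phi> j) (\<phi> k) = (if j = k then 1 else 0)" and \<phi>: "\<And>j. \<phi> j \<in> L2 \<Omega>"
    and dense: "L2_dense \<Omega> (finite_combinations \<phi>)"
    using assms(1) unfolding orthonormal_basis_def by blast+
  note distance = orthonormal_sum_distance[where \<phi> = \<phi> and \<Omega> = \<Omega>, OF on \<phi> h]
  have bessel: "?S n \<le> (L2_norm \<Omega> h)\<^sup>2" for n
    using distance[where n = n and c = "\<lambda>k. L2_inner \<Omega> h (\<phi> k)"]
      zero_le_power2[of "L2_norm \<Omega> (\<lambda>x. h x - (\<Sum>k<n. L2_inner \<Omega> h (\<phi> k) * \<phi> k x))"]
    by (simp only: diff_self norm_zero power_zero_numeral sum.neutral_const)
  have mono: "?S m \<le> ?S n" if "m \<le> n" for m n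
    using that by (intro sum_mono2) auto
  have "?S \<longlonglongrightarrow> (L2_norm \<Omega> h)\<^sup>2"
  proof (rule mono_bounded_LIMSEQ[OF mono bessel])
    fix r :: real assume "0 < r"
    then obtain g where "g \<in> finite_combinations \<phi>"
      and close: "L2_norm \<Omega> (\<lambda>x. h x - g x) < sqrt r"
      using dense h unfolding L2_dense_def by (meson real_sqrt_gt_zero)
    then obtain N c where g: "g = (\<lambda>x. \<Sum>k<N. c k * \<phi> k x)"
      unfolding finite_combinations_def by blast
    have "0 \<le> L2_norm \<Omega> (\<lambda>x. h x - g x)" unfolding L2_norm_def by simp
    then have "(L2_norm \<Omega> (\<lambda>x. h x - g x))\<^sup>2 < (sqrt r)\<^sup>2"
      using close by (intro power_strict_mono) auto
    then have "(L2_norm \<Omega> (\<lambda>x. h x - g x))\<^sup>2 < r" using \<open>0 < r\<close> by simp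
    moreover have "0 \<le> (\<Sum>k<N. (cmod (c k - L2_inner \<Omega> h (\<phi> k)))\<^sup>2)" by (intro sum_nonneg) auto
    moreover have "(L2_norm \<Omega> (\<lambda>x. h x - g x))\<^sup>2 = (L2_norm \<Omega> h)\<^sup>2 - ?S N
        + (\<Sum>k<N. (cmod (c k - L2_inner \<Omega> h (\<phi> k)))\<^sup>2)"
      unfolding g by (rule distance)
    ultimately have "(L2_norm \<Omega> h)\<^sup>2 - ?S N < r" by linarith
    then show "\<exists>N. (L2_norm \<Omega> h)\<^sup>2 - ?S N < r" by (rule exI)
  qed
  then show ?thesis unfolding sums_def .
qed

text \<open>The moments of the weights are real series, for which the real part of the polarization identity
  is enough.\<close>
lemma parseval_polarized:
  assumes ob: "orthonormal_basis \<Omega> \<phi>" and f: "f \<in> L2 \<Omega>" and g: "g \<in> L2 \<Omega>"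
  shows "(\<lambda>k. Re (L2_inner \<Omega> f (\<phi> k) * cnj (L2_inner \<Omega> g (\<phi> k)))) sums Re (L2_inner \<Omega> f g)"
proof -
  have \<phi>: "\<phi> k \<in> L2 \<Omega>" for k using ob unfolding orthonormal_basis_def by blast
  have pol: "((cmod (a + b))\<^sup>2 - (cmod (a - b))\<^sup>2) / 4 = Re (a * cnj b)" for a b
  proof -
    have "(cmod (a + b))\<^sup>2 - (cmod (a - b))\<^sup>2 = 4 * Re (a * cnj b)"
      unfolding cmod_power2 by (simp add: power2_eq_square algebra_simps)
    then show ?thesis by (simp only: nonzero_mult_div_cancel_left[OF zero_neq_numeral[symmetric]])
  qed
  have "(L2_norm \<Omega> (\<lambda>x. f x + g x))\<^sup>2 = (L2_norm \<Omega> f)\<^sup>2 + (L2_norm \<Omega> g)\<^sup>2 + 2 * Re (L2_inner \<Omega> f g)"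
    using L2_norm_power2_lincomb[OF f g, of 1 1] by simp
  moreover have "(L2_norm \<Omega> (\<lambda>x. f x - g x))\<^sup>2 = (L2_norm \<Omega> f)\<^sup>2 + (L2_norm \<Omega> g)\<^sup>2 - 2 * Re (L2_inner \<Omega> f g)"
    using L2_norm_power2_lincomb[OF f g, of 1 "-1"] by simp
  ultimately have norms: "((L2_norm \<Omega> (\<lambda>x. f x + g x))\<^sup>2 - (L2_norm \<Omega> (\<lambda>x. f x - g x))\<^sup>2) / 4 = Re (L2_inner \<Omega> f g)"
    by simp
  have coeffs: "((cmod (L2_inner \<Omega> (\<lambda>x. f x + g x) (\<phi> k)))\<^sup>2 - (cmod (L2_inner \<Omega> (\<lambda>x. f x - g x) (\<phi> k)))\<^sup>2) / 4
      = Re (L2_inner \<Omega> f (\<phi> k) * cnj (L2_inner \<Omega> g (\<phi> k)))" for k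
    unfolding L2_inner_add_left[OF f g \<phi>] L2_inner_diff_left[OF f g \<phi>] by (rule pol)
  show ?thesis
    using sums_divide[OF sums_diff[OF parseval[OF ob L2_add[OF f g]] parseval[OF ob L2_diff[OF f g]]], of 4]
    unfolding norms coeffs .
qed

section \<open>Differentiation of smooth functions and of plane waves\<close>

lemma pderiv_at_eqI:
  assumes "\<And>x. (f has_derivative F x) (at x)"
  shows "pderiv_at i f = (\<lambda>x. F x (axis i 1))"
  unfolding pderiv_at_def using frechet_derivative_at[OF assms] by simp

lemma differentiable_imp_frechet:
  "(f::real^'d \<Rightarrow> complex) differentiable (at x) \<Longrightarrow> (f has_derivative frechet_derivative f (at x)) (at x)"
  using frechet_derivative_works by blast

lemma pderiv_at_mult:
  assumes "\<And>x. f differentiable (at x)" "\<And>x. g differentiable (at x)"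
  shows "pderiv_at i (\<lambda>x. f x * g x) = (\<lambda>x. f x * pderiv_at i g x + pderiv_at i f x * g x)"
  using pderiv_at_eqI[OF has_derivative_mult[OF differentiable_imp_frechet[OF assms(1)]
        differentiable_imp_frechet[OF assms(2)]]]
  by (simp add: pderiv_at_def)

lemma pderiv_at_add:
  assumes "\<And>x. f differentiable (at x)" "\<And>x. g differentiable (at x)"
  shows "pderiv_at i (\<lambda>x. f x + g x) = (\<lambda>x. pderiv_at i f x + pderiv_at i g x)"
  using pderiv_at_eqI[OF has_derivative_add[OF differentiable_imp_frechet[OF assms(1)]
        differentiable_imp_frechet[OF assms(2)]]]
  by (simp add: pderiv_at_def)

lemma pderiv_at_const: "pderiv_at i (\<lambda>x. c) = (\<lambda>x. 0)"
  using pderiv_at_eqI[OF has_derivative_const] .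

lemma pderiv_at_scale:
  assumes "\<And>x. f differentiable (at x)"
  shows "pderiv_at i (\<lambda>x. c * f x) = (\<lambda>x. c * pderiv_at i f x)"
  using pderiv_at_mult[of "\<lambda>x. c" f i] assms by (simp add: pderiv_at_const)

lemma Ck_imp_continuous: "Ck n f \<Longrightarrow> continuous_on UNIV f"
  by (cases n) (auto intro!: continuous_at_imp_continuous_on differentiable_imp_continuous_within)

lemma Ck_SucD: "Ck (Suc n) f \<Longrightarrow> Ck n f"
proof (induction n arbitrary: f)
  case 0
  then show ?case using Ck_imp_continuous Ck.simps(1) by blast
next
  case (Suc n)
  show ?case unfolding Ck.simps(2)[of n]
    using Suc.prems Suc.IH unfolding Ck.simps(2)[of "Suc n"] by blast
qed

lemma Ck_const: "Ck n (\<lambda>x. c)"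
  by (induction n arbitrary: c) (simp_all add: pderiv_at_const)

lemma Ck_add: "Ck n f \<Longrightarrow> Ck n g \<Longrightarrow> Ck n (\<lambda>x. f x + g x)"
  by (induction n arbitrary: f g) (auto simp: pderiv_at_add intro: continuous_on_add)

lemma Ck_mult: "Ck n f \<Longrightarrow> Ck n g \<Longrightarrow> Ck n (\<lambda>x. f x * g x)"
proof (induction n arbitrary: f g)
  case 0
  then show ?case by (auto intro: continuous_on_mult)
next
  case (Suc n)
  then have diff: "\<And>x. f differentiable (at x)" "\<And>x. g differentiable (at x)" by auto
  have "Ck n (\<lambda>x. f x * pderiv_at i g x + pderiv_at i f x * g x)" for i
    using Suc.prems Ck_SucD by (intro Ck_add Suc.IH) auto
  then show ?case using diff by (simp add: pderiv_at_mult)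
qed

lemma Ck_diff: "Ck n f \<Longrightarrow> Ck n g \<Longrightarrow> Ck n (\<lambda>x. f x - g x)"
  using Ck_add[of n f "\<lambda>x. -1 * g x"] Ck_mult[OF Ck_const, of n g "-1"] by simp

lemma Ck_prod: "(\<And>i. i \<in> A \<Longrightarrow> Ck n (f i)) \<Longrightarrow> Ck n (\<lambda>x. \<Prod>i\<in>A. f i x)"
  by (induction A rule: infinite_finite_induct) (auto intro: Ck_const Ck_mult)

lemma Ck_power: "Ck n f \<Longrightarrow> Ck n (\<lambda>x. f x ^ m)"
  by (induction m) (auto intro: Ck_const Ck_mult)

lemma plane_wave_has_derivative:
  "((\<lambda>x. exp (\<i> * of_real (p \<bullet> x))) has_derivative (\<lambda>h. \<i> * of_real (p \<bullet> h) * exp (\<i> * of_real (p \<bullet> x)))) (at x)"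
proof -
  have "((\<lambda>x. \<i> * of_real (p \<bullet> x)) has_derivative (\<lambda>h. \<i> * of_real (p \<bullet> h))) (at x)"
    by (auto intro!: derivative_eq_intros)
  from has_derivative_compose[OF this has_field_derivative_imp_has_derivative[OF DERIV_exp]]
  show ?thesis by (simp add: mult.commute)
qed

lemma pderiv_at_plane_wave:
  "pderiv_at i (\<lambda>x. exp (\<i> * of_real (p \<bullet> x))) = (\<lambda>x. \<i> * of_real (p $ i) * exp (\<i> * of_real (p \<bullet> x)))"
  using pderiv_at_eqI[OF plane_wave_has_derivative] by (simp add: inner_axis)

lemma plane_wave_differentiable: "(\<lambda>x. exp (\<i> * of_real (p \<bullet> x))) differentiable (at x)"
  using plane_wave_has_derivative differentiable_def by blast

lemma Ck_plane_wave: "Ck n (\<lambda>x. exp (\<i> * of_real (p \<bullet> x)))"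
proof (induction n)
  case 0
  show ?case by (auto intro!: continuous_intros)
next
  case (Suc n)
  then show ?case
    unfolding Ck.simps pderiv_at_plane_wave
    using plane_wave_differentiable Ck_mult[OF Ck_const] by blast
qed

lemma test_function_mult:
  assumes "\<And>n. Ck n g" "test_function \<Omega> \<psi>"
  shows "test_function \<Omega> (\<lambda>x. g x * \<psi> x)"
proof -
  have sub: "closure {x. g x * \<psi> x \<noteq> 0} \<subseteq> closure {x. \<psi> x \<noteq> 0}"
    by (intro closure_mono) auto
  then have "compact (closure {x. g x * \<psi> x \<noteq> 0})"
    using assms(2) compact_Int_closed[of "closure {x. \<psi> x \<noteq> 0}" "closure {x. g x * \<psi> x \<noteq> 0}"]
    unfolding test_function_def by (simp add: Int_absorb1)
  with sub show ?thesis
    using assms Ck_mult unfolding test_function_def by blast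
qed

lemma test_function_Ck: "test_function \<Omega> \<psi> \<Longrightarrow> Ck n \<psi>"
  and test_function_Ck_pderiv: "test_function \<Omega> \<psi> \<Longrightarrow> Ck n (pderiv_at i \<psi>)"
  unfolding test_function_def using Ck.simps(2) by blast+

text \<open>Conjugation with a plane wave shifts each partial derivative by a multiple of the identity; applied
  twice, this is the source of the gradient and of \<open>|p|\<^sup>2\<close> in the conjugated operator.\<close>
lemma pderiv_at_plane_wave_mult:
  assumes "\<And>x. u differentiable (at x)"
  shows "pderiv_at i (\<lambda>x. exp (\<i> * of_real (p \<bullet> x)) * u x)
    = (\<lambda>x. exp (\<i> * of_real (p \<bullet> x)) * (pderiv_at i u x + \<i> * of_real (p $ i) * u x))"
  using pderiv_at_mult[OF plane_wave_differentiable[of p] assms, of i]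
  by (simp add: pderiv_at_plane_wave algebra_simps)

lemma pderiv_at_twice_plane_wave_mult:
  assumes "Ck 2 u"
  shows "pderiv_at i (pderiv_at i (\<lambda>x. exp (\<i> * of_real (p \<bullet> x)) * u x))
    = (\<lambda>x. exp (\<i> * of_real (p \<bullet> x)) *
        (pderiv_at i (pderiv_at i u) x + 2 * \<i> * of_real (p $ i) * pderiv_at i u x - (of_real (p $ i))\<^sup>2 * u x))"
proof -
  have "Ck (Suc (Suc 0)) u" using assms by (simp add: numeral_2_eq_2)
  then have d: "\<And>x. u differentiable (at x)" "\<And>x. pderiv_at i u differentiable (at x)"
    by simp_all
  have ds: "(\<lambda>x. \<i> * of_real (p $ i) * u x) differentiable (at x)" for x
    using d(1) by simp
  have sum: "pderiv_at i (\<lambda>x. pderiv_at i u x + \<i> * of_real (p $ i) * u x)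
      = (\<lambda>x. pderiv_at i (pderiv_at i u) x + \<i> * of_real (p $ i) * pderiv_at i u x)"
    using pderiv_at_add[OF d(2) ds, of i] unfolding pderiv_at_scale[OF d(1)] .
  have dsum: "(\<lambda>x. pderiv_at i u x + \<i> * of_real (p $ i) * u x) differentiable (at x)" for x
    using d(2) ds by (rule differentiable_add)
  show ?thesis
    unfolding pderiv_at_plane_wave_mult[OF d(1)] pderiv_at_plane_wave_mult[OF dsum] sum
    by (simp add: algebra_simps power2_eq_square)
qed

section \<open>Smooth bumps\<close>

text \<open>The case \<open>p = 1\<close> is the standard smooth function that is flat at the origin.  The polynomial factor
  makes the class closed under differentiation, so that smoothness follows by induction from one
  derivative.\<close>
definition flat_exp :: "real poly \<Rightarrow> real \<Rightarrow> real" where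
  "flat_exp p t = (if 0 < t then poly p (1 / t) * exp (- (1 / t)) else 0)"

lemma poly_times_exp_tendsto_0: "((\<lambda>s. poly p s * exp (- s)) \<longlongrightarrow> (0::real)) at_top"
proof -
  have "((\<lambda>s. \<Sum>i\<le>degree p. coeff p i * (s ^ i / exp s)) \<longlongrightarrow> (\<Sum>i\<le>degree p. coeff p i * (0::real))) at_top"
    by (intro tendsto_sum tendsto_mult tendsto_const tendsto_power_div_exp_0)
  then show ?thesis
    by (simp add: poly_altdef sum_distrib_right exp_minus divide_inverse mult.assoc)
qed

text \<open>Away from the origin this is the chain rule for \<open>s = 1 / t\<close>, where \<open>ds/dt = - s\<^sup>2\<close>; at the origin the
  difference quotient is \<open>s p(s) exp (- s)\<close>, which decays as \<open>s\<close> tends to infinity.\<close>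
lemma flat_exp_has_derivative:
  "(flat_exp p has_real_derivative flat_exp (monom 1 2 * (p - pderiv p)) t) (at t)"
proof (cases t "0::real" rule: linorder_cases)
  case less
  show ?thesis
    by (rule has_field_derivative_transform_within_open[of "\<lambda>_. 0" _ _ "{..<0}"])
      (use less in \<open>auto simp: flat_exp_def\<close>)
next
  case equal
  have "((\<lambda>h. poly (pCons 0 p) (inverse h) * exp (- inverse h)) \<longlongrightarrow> 0) (at_right 0)"
    by (rule filterlim_compose[OF poly_times_exp_tendsto_0 filterlim_inverse_at_top_right])
  then have "((\<lambda>h. flat_exp p h / h) \<longlongrightarrow> 0) (at_right 0)"
    by (rule Lim_transform_eventually)
      (auto simp: flat_exp_def divide_inverse intro!: eventually_at_rightI[of 0 1])
  moreover have "((\<lambda>h. flat_exp p h / h) \<longlongrightarrow> 0) (at_left 0)"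
    by (rule Lim_transform_eventually[OF tendsto_const])
      (auto simp: flat_exp_def intro!: eventually_at_leftI[of "-1" 0])
  ultimately have "((\<lambda>h. flat_exp p h / h) \<longlongrightarrow> 0) (at 0)"
    by (simp add: filterlim_at_split)
  then show ?thesis using equal by (simp add: DERIV_def flat_exp_def)
next
  case greater
  have p: "((\<lambda>t. poly p (1 / t)) has_real_derivative poly (pderiv p) (1 / t) * (- (1 / t\<^sup>2))) (at t)"
    using greater
    by (intro DERIV_chain2[OF poly_DERIV]) (auto intro!: derivative_eq_intros simp: power2_eq_square)
  have e: "((\<lambda>t. exp (- (1 / t))) has_real_derivative exp (- (1 / t)) * (1 / t\<^sup>2)) (at t)"
    using greater
    by (intro DERIV_chain2[OF DERIV_exp]) (auto intro!: derivative_eq_intros simp: power2_eq_square)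
  have "((\<lambda>t. poly p (1 / t) * exp (- (1 / t))) has_real_derivative
      poly (monom 1 2 * (p - pderiv p)) (1 / t) * exp (- (1 / t))) (at t)"
    using DERIV_mult[OF p e] by (simp add: poly_monom power_one_over algebra_simps)
  then have "(flat_exp p has_real_derivative
      poly (monom 1 2 * (p - pderiv p)) (1 / t) * exp (- (1 / t))) (at t)"
    by (rule has_field_derivative_transform_within_open[of _ _ _ "{0<..}"])
      (use greater in \<open>auto simp: flat_exp_def\<close>)
  then show ?thesis using greater by (simp add: flat_exp_def)
qed

lemma flat_exp_1: "0 \<le> flat_exp 1 t" "flat_exp 1 t \<le> 1" "flat_exp 1 t \<noteq> 0 \<longleftrightarrow> 0 < t"
  by (auto simp: flat_exp_def)

lemma Ck_flat_exp: "Ck n (\<lambda>x. complex_of_real (flat_exp p (c * x $ i + d)))"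
proof (induction n arbitrary: p)
  case 0
  have "continuous_on UNIV (flat_exp p)"
    using flat_exp_has_derivative DERIV_isCont by (blast intro: continuous_at_imp_continuous_on)
  then have "continuous_on UNIV (\<lambda>x::real^'a. flat_exp p (c * x $ i + d))"
    by (rule continuous_on_compose2) (auto intro!: continuous_intros)
  then show ?case by (auto intro: continuous_on_of_real)
next
  case (Suc n)
  define r where "r = monom 1 2 * (p - pderiv p)"
  have "((\<lambda>x::real^'a. c * x $ i + d) has_derivative (\<lambda>h. c * h $ i)) (at x)" for x
    by (auto intro!: derivative_eq_intros bounded_linear.has_derivative[OF bounded_linear_vec_nth])
  from has_derivative_compose[OF this has_field_derivative_imp_has_derivative[OF flat_exp_has_derivative]]
  have "((\<lambda>x::real^'a. complex_of_real (flat_exp p (c * x $ i + d))) has_derivative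
      (\<lambda>h. complex_of_real (flat_exp r (c * x $ i + d) * (c * h $ i)))) (at x)" for x
    unfolding r_def by (rule has_derivative_of_real)
  note D = this
  have "Ck n (\<lambda>x. complex_of_real (flat_exp r (c * x $ i + d)) * complex_of_real (c * axis j 1 $ i))" for j
    using Suc by (intro Ck_mult Ck_const)
  then show ?case
    using D unfolding Ck.simps pderiv_at_eqI[OF D] of_real_mult differentiable_def by blast
qed

text \<open>A smooth function with values in the unit interval that is positive exactly on the open box.\<close>
definition box_bump :: "real^'d \<Rightarrow> real^'d \<Rightarrow> real^'d \<Rightarrow> real" where
  "box_bump a b x = (\<Prod>i\<in>UNIV. flat_exp 1 (x $ i - a $ i) * flat_exp 1 (b $ i - x $ i))"

lemma box_bump_nonneg: "0 \<le> box_bump a b x"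
  unfolding box_bump_def by (intro prod_nonneg) (simp add: flat_exp_1)

lemma box_bump_le_1: "box_bump a b x \<le> 1"
  unfolding box_bump_def by (intro prod_le_1) (auto simp: flat_exp_1 mult_le_one)

lemma box_bump_pos_iff: "0 < box_bump a b x \<longleftrightarrow> x \<in> box a b"
proof -
  have "0 < box_bump a b x \<longleftrightarrow> box_bump a b x \<noteq> 0"
    using box_bump_nonneg[of a b x] by linarith
  also have "\<dots> \<longleftrightarrow> (\<forall>i. flat_exp 1 (x $ i - a $ i) \<noteq> 0 \<and> flat_exp 1 (b $ i - x $ i) \<noteq> 0)"
    by (simp add: box_bump_def)
  also have "\<dots> \<longleftrightarrow> x \<in> box a b"
    by (simp only: flat_exp_1(3) mem_box_cart diff_gt_0_iff_gt)
  finally show ?thesis .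
qed

lemma Ck_box_bump: "Ck n (\<lambda>x. complex_of_real (box_bump a b x))"
proof -
  have "Ck n (\<lambda>x. complex_of_real (flat_exp 1 (1 * x $ i + (- a $ i))) * complex_of_real (flat_exp 1 (-1 * x $ i + b $ i)))" for i
    by (intro Ck_mult Ck_flat_exp)
  then show ?thesis
    unfolding box_bump_def of_real_prod of_real_mult by (intro Ck_prod) (simp add: algebra_simps)
qed

text \<open>The closed boxes have to stay inside the open set: they will carry the supports of test
  functions.\<close>
lemma open_eq_UN_boxes:
  fixes U :: "(real^'d) set"
  assumes "open U"
  shows "\<exists>(a :: nat \<Rightarrow> real^'d) b. U = (\<Union>n. box (a n) (b n)) \<and> (\<forall>n. cbox (a n) (b n) \<subseteq> U)"
proof -
  define F where "F = {box a b | a b. cbox a b \<subseteq> U}"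
  have "\<Union>F = U"
  proof
    show "\<Union>F \<subseteq> U" unfolding F_def using box_subset_cbox by blast
    show "U \<subseteq> \<Union>F"
    proof
      fix x assume "x \<in> U"
      then obtain a b where "cbox a b \<subseteq> U" "x \<in> box a b"
        using open_contains_cbox[OF assms] by metis
      then show "x \<in> \<Union>F" unfolding F_def by blast
    qed
  qed
  note F = this
  have "open S" if "S \<in> F" for S using that open_box unfolding F_def by blast
  then obtain F' where F': "F' \<subseteq> F" "countable F'" "\<Union>F' = \<Union>F"
    by (rule Lindelof)
  \<comment> \<open>Adding the empty box makes the family nonempty, so that it can be enumerated.\<close>
  define B where "B = from_nat_into (insert {} F')"
  have range: "range B = insert {} F'"
    unfolding B_def using F'(2) by (intro range_from_nat_into) auto
  have "box (1::real^'d) 0 = {}" "cbox (1::real^'d) 0 = {}"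
    by (auto simp: interval_eq_empty_cart)
  then have "{} \<in> F" unfolding F_def mem_Collect_eq by (intro exI[of _ 1] exI[of _ 0]) simp
  then have "range B \<subseteq> F" unfolding range using F'(1) by simp
  then have "B n \<in> F" for n by (rule subsetD) (rule rangeI)
  then have "\<forall>n. \<exists>a b. B n = box a b \<and> cbox a b \<subseteq> U" unfolding F_def by simp
  then obtain a b where ab: "\<And>n. B n = box (a n) (b n)" "\<And>n. cbox (a n) (b n) \<subseteq> U"
    unfolding choice_iff by blast
  have "U = (\<Union>n. box (a n) (b n))"
    using F F'(3) range by (simp add: ab(1)[symmetric])
  then show ?thesis using ab(2) by (intro exI[of _ a] exI[of _ b] conjI allI)
qed

text \<open>Cover the open set by boxes with bumps \<open>\<beta>\<^sub>i\<close>.  In \<open>\<psi>\<^sub>n = 1 - (\<Prod>i<n. (1 - \<beta>\<^sub>i) ^ n)\<close> the product equals 1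
  outside the first \<open>n\<close> boxes, which gives compact support, and tends to 0 wherever some \<open>\<beta>\<^sub>i\<close> is
  positive, because of the growing exponent.\<close>
lemma test_functions_approximate_open:
  fixes U :: "(real^'d) set"
  assumes "open U" "U \<subseteq> \<Omega>"
  obtains \<psi> :: "nat \<Rightarrow> real^'d \<Rightarrow> complex" where "\<And>n. test_function \<Omega> (\<psi> n)" "\<And>n x. cmod (\<psi> n x) \<le> 1"
    "\<And>x. (\<lambda>n. \<psi> n x) \<longlonglongrightarrow> indicator U x"
proof -
  obtain a b :: "nat \<Rightarrow> real^'d" where ab: "U = (\<Union>n. box (a n) (b n)) \<and> (\<forall>n. cbox (a n) (b n) \<subseteq> U)"
    using open_eq_UN_boxes[OF assms(1)] by blast
  note U = conjunct1[OF ab] conjunct2[OF ab, rule_format]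
  define P where "P n x = (\<Prod>i<n. (1 - box_bump (a i) (b i) x) ^ n)" for n x
  define \<psi> where "\<psi> n x = 1 - complex_of_real (P n x)" for n x
  have factor: "0 \<le> 1 - box_bump (a i) (b i) x" "1 - box_bump (a i) (b i) x \<le> 1" for i x
    using box_bump_nonneg[of "a i" "b i" x] box_bump_le_1[of "a i" "b i" x] by auto
  have P0: "0 \<le> P n x" for n x
    unfolding P_def by (intro prod_nonneg zero_le_power factor)
  have P1: "P n x \<le> 1" for n x
    unfolding P_def by (intro prod_le_1 conjI zero_le_power power_le_one factor)
  have outside: "P n x = 1" if out: "\<And>i. i < n \<Longrightarrow> x \<notin> box (a i) (b i)" for n x
  proof -
    have "box_bump (a i) (b i) x = 0" if "i < n" for i
    proof -
      have "\<not> 0 < box_bump (a i) (b i) x"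
        unfolding box_bump_pos_iff using out[OF that] .
      then show ?thesis using box_bump_nonneg[of "a i" "b i" x] by linarith
    qed
    then show ?thesis unfolding P_def by (simp add: prod.neutral)
  qed
  have "test_function \<Omega> (\<psi> n)" for n
  proof -
    have "Ck m (\<psi> n)" for m
      unfolding \<psi>_def P_def of_real_prod of_real_power of_real_diff of_real_1
      by (intro Ck_diff Ck_prod Ck_power Ck_const Ck_box_bump)
    moreover have "{x. \<psi> n x \<noteq> 0} \<subseteq> (\<Union>i<n. cbox (a i) (b i))"
    proof
      fix x assume "x \<in> {x. \<psi> n x \<noteq> 0}"
      then have "P n x \<noteq> 1" unfolding \<psi>_def by auto
      then obtain i where "i < n" "x \<in> box (a i) (b i)" using outside[of n x] by auto
      then show "x \<in> (\<Union>i<n. cbox (a i) (b i))"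
        using box_subset_cbox[of "a i" "b i"] by (intro UN_I[of i]) (simp, rule subsetD)
    qed
    then have "closure {x. \<psi> n x \<noteq> 0} \<subseteq> (\<Union>i<n. cbox (a i) (b i))"
      by (intro closure_minimal) (auto intro: closed_UN)
    moreover have "compact (\<Union>i<n. cbox (a i) (b i))" by (intro compact_UN) auto
    moreover have "(\<Union>i<n. cbox (a i) (b i)) \<subseteq> \<Omega>" using U(2) assms(2) by blast
    ultimately show ?thesis
      using compact_Int_closed[of "\<Union>i<n. cbox (a i) (b i)" "closure {x. \<psi> n x \<noteq> 0}"]
      unfolding test_function_def by (auto simp: Int_absorb1)
  qed
  moreover have "cmod (\<psi> n x) \<le> 1" for n x
  proof -
    have "\<psi> n x = complex_of_real (1 - P n x)" by (simp add: \<psi>_def)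
    then show ?thesis using P0[of n x] P1[of n x] by (simp only: norm_of_real)
  qed
  moreover have "(\<lambda>n. \<psi> n x) \<longlonglongrightarrow> indicator U x" for x
  proof (cases "x \<in> U")
    case False
    then have "\<psi> n x = 0" for n using outside[of n x] U(1) by (auto simp: \<psi>_def)
    then show ?thesis using False by simp
  next
    case True
    then obtain k where k: "x \<in> box (a k) (b k)" using U(1) by blast
    define s where "s = 1 - box_bump (a k) (b k) x"
    have s: "0 \<le> s" "s < 1"
      using k factor(1)[of k x] box_bump_pos_iff[of "a k" "b k" x] unfolding s_def by auto
    have "P n x \<le> s ^ n" if "k < n" for n
    proof -
      have "P n x = s ^ n * (\<Prod>i\<in>{..<n} - {k}. (1 - box_bump (a i) (b i) x) ^ n)"
        unfolding P_def s_def using that by (subst prod.remove[of _ k]) auto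
      also have "\<dots> \<le> s ^ n * 1"
        by (intro mult_left_mono prod_le_1 conjI zero_le_power power_le_one factor s)
      finally show ?thesis by simp
    qed
    then have "\<forall>\<^sub>F n in sequentially. P n x \<le> s ^ n"
      by (auto simp: eventually_sequentially intro!: exI[of _ "Suc k"])
    then have "(\<lambda>n. P n x) \<longlonglongrightarrow> 0"
      by (rule tendsto_sandwich[OF always_eventually _ tendsto_const LIMSEQ_realpow_zero[OF s], rotated])
        (simp add: P0)
    then have "(\<lambda>n. \<psi> n x) \<longlonglongrightarrow> 1 - complex_of_real 0"
      unfolding \<psi>_def by (intro tendsto_intros)
    then show ?thesis using True by simp
  qed
  ultimately show thesis by (rule that)
qed

section \<open>Test functions separate integrable functions\<close>

text \<open>Up to a null set, the set where \<open>v\<close> is positive is a countable intersection of open sets.  By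
  dominated convergence the integral of \<open>v\<close> over it vanishes as well, which forces it to be null.\<close>
lemma AE_nonpos_of_integral_open_eq_0:
  fixes v :: "real^'d \<Rightarrow> real"
  assumes \<Omega>: "open \<Omega>" and v: "integrable (lebesgue_on \<Omega>) v"
    and zero: "\<And>U. open U \<Longrightarrow> U \<subseteq> \<Omega> \<Longrightarrow> (LINT x|lebesgue_on \<Omega>. indicator U x * v x) = 0"
  shows "AE x in lebesgue_on \<Omega>. v x \<le> 0"
proof -
  have \<Omega>': "\<Omega> \<in> sets lebesgue" using \<Omega> by (simp add: borel_open)
  define S where "S = {x \<in> \<Omega>. 0 < v x}"
  have "{x \<in> space (lebesgue_on \<Omega>). 0 < v x} \<in> sets (lebesgue_on \<Omega>)"
    using v by measurable
  then have SM: "S \<in> sets (lebesgue_on \<Omega>)" by (simp add: S_def)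
  then have S: "S \<in> sets lebesgue" using \<Omega>' by (simp add: sets_restrict_space_iff)
  obtain C T where C: "gdelta C" "T \<in> null_sets lebesgue" "S \<union> T = C" "disjnt S T"
    using lebesgue_set_almost_gdelta[OF S] .
  obtain F :: "nat \<Rightarrow> (real^'d) set" where F: "\<And>n. open (F n)" "C = (\<Inter>n. F n)"
    using C(1) by (auto elim: gdelta.cases)
  define G where "G n = \<Omega> \<inter> (\<Inter>m\<le>n. F m)" for n
  have G: "open (G n)" "G n \<subseteq> \<Omega>" for n
    unfolding G_def using \<Omega> F(1) by (auto intro!: open_Int open_INT)
  have GM: "G n \<in> sets (lebesgue_on \<Omega>)" for n
    using G[of n] \<Omega>' by (simp add: sets_restrict_space_iff borel_open)
  have AE: "AE x in lebesgue_on \<Omega>. (\<lambda>n. indicator (G n) x * v x) \<longlonglongrightarrow> indicator S x * v x"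
  proof -
    have "AE x in lebesgue. x \<notin> T" using C(2) by (rule AE_not_in)
    then have "AE x in lebesgue_on \<Omega>. x \<notin> T" 
      using \<Omega>' by (subst AE_restrict_space_iff) (auto elim: eventually_mono)
    moreover have "AE x in lebesgue_on \<Omega>. x \<in> \<Omega>" by (rule AE_I2) simp
    ultimately show ?thesis
    proof eventually_elim
      fix x assume x: "x \<notin> T" "x \<in> \<Omega>"
      show "(\<lambda>n. indicator (G n) x * v x) \<longlonglongrightarrow> indicator S x * v x"
      proof (cases "x \<in> S")
        case True
        then have "x \<in> G n" for n using x C(3) F(2) by (auto simp: G_def)
        then show ?thesis using True by simp
      next
        case False
        then obtain N where N: "x \<notin> F N" using x C(3) F(2) by auto
        have "\<forall>\<^sub>F n in sequentially. indicator (G n) x * v x = 0"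
        proof (rule eventually_sequentiallyI)
          fix n assume "N \<le> n"
          then have "x \<notin> G n" using N by (auto simp: G_def)
          then show "indicator (G n) x * v x = 0" by simp
        qed
        then show ?thesis using False by (simp add: tendsto_eventually)
      qed
    qed
  qed
  have vm: "v \<in> borel_measurable (lebesgue_on \<Omega>)" using v by auto
  have "(\<lambda>n. LINT x|lebesgue_on \<Omega>. indicator (G n) x * v x) \<longlonglongrightarrow> (LINT x|lebesgue_on \<Omega>. indicator S x * v x)"
  proof (rule integral_dominated_convergence[OF _ _ integrable_norm[OF v] AE])
    show "(\<lambda>x. indicator S x * v x) \<in> borel_measurable (lebesgue_on \<Omega>)"
      using SM vm by measurable
    show "(\<lambda>x. indicator (G n) x * v x) \<in> borel_measurable (lebesgue_on \<Omega>)" for n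
      using GM[of n] vm by measurable
    show "AE x in lebesgue_on \<Omega>. norm (indicator (G n) x * v x) \<le> norm (v x)" for n
      by (auto simp: indicator_def)
  qed
  then have "(LINT x|lebesgue_on \<Omega>. indicator S x * v x) = 0"
    using zero[OF G] by (simp add: LIMSEQ_const_iff)
  moreover have "integrable (lebesgue_on \<Omega>) (\<lambda>x. indicator S x * v x)"
    using integrable_mult_indicator[OF SM v] by simp
  moreover have "AE x in lebesgue_on \<Omega>. 0 \<le> indicator S x * v x"
    by (rule AE_I2) (auto simp: S_def indicator_def)
  ultimately have "AE x in lebesgue_on \<Omega>. indicator S x * v x = 0"
    using integral_nonneg_eq_0_iff_AE[of "lebesgue_on \<Omega>" "\<lambda>x. indicator S x * v x"] by simp
  moreover have "AE x in lebesgue_on \<Omega>. x \<in> \<Omega>" by (rule AE_I2) simp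
  ultimately show ?thesis
  proof eventually_elim
    fix x assume "indicator S x * v x = 0" "x \<in> \<Omega>"
    then show "v x \<le> 0" by (cases "x \<in> S") (auto simp: S_def)
  qed
qed

lemma AE_zero_of_integral_open_eq_0:
  fixes v :: "real^'d \<Rightarrow> real"
  assumes \<Omega>: "open \<Omega>" and v: "integrable (lebesgue_on \<Omega>) v"
    and zero: "\<And>U. open U \<Longrightarrow> U \<subseteq> \<Omega> \<Longrightarrow> (LINT x|lebesgue_on \<Omega>. indicator U x * v x) = 0"
  shows "AE x in lebesgue_on \<Omega>. v x = 0"
proof -
  have "AE x in lebesgue_on \<Omega>. v x \<le> 0"
    using assms by (rule AE_nonpos_of_integral_open_eq_0)
  moreover have "AE x in lebesgue_on \<Omega>. - v x \<le> 0"
    using assms by (intro AE_nonpos_of_integral_open_eq_0) auto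
  ultimately show ?thesis by eventually_elim simp
qed

text \<open>The fundamental lemma of the calculus of variations: pass from test functions to indicators of
  open sets by dominated convergence, then treat real and imaginary parts separately.\<close>
lemma test_functions_separate:
  fixes u :: "real^'d \<Rightarrow> complex"
  assumes \<Omega>: "open \<Omega>" and u: "integrable (lebesgue_on \<Omega>) u"
    and zero: "\<And>\<psi>. test_function \<Omega> \<psi> \<Longrightarrow> (LINT x|lebesgue_on \<Omega>. u x * \<psi> x) = 0"
  shows "AE x in lebesgue_on \<Omega>. u x = 0"
proof -
  have \<Omega>': "\<Omega> \<in> sets lebesgue" using \<Omega> by (simp add: borel_open)
  have ind: "indicat_real U x *\<^sub>R u x = indicator U x * u x" for U x
    by (auto simp: indicator_def)
  have open0: "(LINT x|lebesgue_on \<Omega>. indicator U x * u x) = 0" and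
    openI: "integrable (lebesgue_on \<Omega>) (\<lambda>x. indicator U x * u x)" if U: "open U" "U \<subseteq> \<Omega>" for U
  proof -
    obtain \<psi> :: "nat \<Rightarrow> real^'d \<Rightarrow> complex" where \<psi>: "\<And>n. test_function \<Omega> (\<psi> n)" "\<And>n x. cmod (\<psi> n x) \<le> 1"
      "\<And>x. (\<lambda>n. \<psi> n x) \<longlonglongrightarrow> indicator U x"
      using test_functions_approximate_open[OF U] by blast
    have um: "u \<in> borel_measurable (lebesgue_on \<Omega>)" using u by auto
    have UM: "U \<in> sets (lebesgue_on \<Omega>)"
      using U \<Omega>' by (simp add: sets_restrict_space_iff borel_open)
    have "(\<lambda>n. LINT x|lebesgue_on \<Omega>. u x * \<psi> n x) \<longlonglongrightarrow> (LINT x|lebesgue_on \<Omega>. u x * indicator U x)"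
    proof (rule integral_dominated_convergence[OF _ _ integrable_norm[OF u]])
      show "(\<lambda>x. u x * indicator U x) \<in> borel_measurable (lebesgue_on \<Omega>)"
        using UM um by measurable
      show "(\<lambda>x. u x * \<psi> n x) \<in> borel_measurable (lebesgue_on \<Omega>)" for n
      proof -
        have "continuous_on \<Omega> (\<psi> n)"
          using \<psi>(1)[of n] Ck_imp_continuous continuous_on_subset unfolding test_function_def by blast
        then have "\<psi> n \<in> borel_measurable (lebesgue_on \<Omega>)"
          using \<Omega>' by (rule continuous_imp_measurable_on_sets_lebesgue)
        then show ?thesis using um by measurable
      qed
      show "AE x in lebesgue_on \<Omega>. (\<lambda>n. u x * \<psi> n x) \<longlonglongrightarrow> u x * indicator U x"
        by (intro AE_I2 tendsto_mult tendsto_const \<psi>(3))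
      show "AE x in lebesgue_on \<Omega>. norm (u x * \<psi> n x) \<le> norm (u x)" for n
        using \<psi>(2)[of n] by (auto simp: norm_mult mult_left_le)
    qed
    then show "(LINT x|lebesgue_on \<Omega>. indicator U x * u x) = 0"
      using zero[OF \<psi>(1)] by (simp add: LIMSEQ_const_iff mult.commute)
    show "integrable (lebesgue_on \<Omega>) (\<lambda>x. indicator U x * u x)"
      using integrable_mult_indicator[OF UM u] unfolding ind .
  qed
  have parts: "Re (indicator U x * u x) = indicator U x * Re (u x)"
    "Im (indicator U x * u x) = indicator U x * Im (u x)" for U x
    by (auto simp: indicator_def)
  have "AE x in lebesgue_on \<Omega>. Re (u x) = 0"
  proof (rule AE_zero_of_integral_open_eq_0[OF \<Omega> integrable_Re[OF u]])
    fix U assume "open U" "U \<subseteq> \<Omega>"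
    then show "(LINT x|lebesgue_on \<Omega>. indicator U x * Re (u x)) = 0"
      using open0 integral_Re[OF openI, of U] by (simp add: parts del: times_complex.sel)
  qed
  moreover have "AE x in lebesgue_on \<Omega>. Im (u x) = 0"
  proof (rule AE_zero_of_integral_open_eq_0[OF \<Omega> integrable_Im[OF u]])
    fix U assume "open U" "U \<subseteq> \<Omega>"
    then show "(LINT x|lebesgue_on \<Omega>. indicator U x * Im (u x)) = 0"
      using open0 integral_Im[OF openI, of U] by (simp add: parts del: times_complex.sel)
  qed
  ultimately show ?thesis by eventually_elim (simp add: complex_eq_iff)
qed

section \<open>Multiplication by plane waves\<close>

lemma L2_plane_wave_mult:
  assumes "\<Omega> \<in> sets lebesgue" "f \<in> L2 \<Omega>"
  shows "plane_wave_mult p f \<in> L2 \<Omega>"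
  unfolding plane_wave_mult_def
proof (rule L2_bounded_mult[OF assms(2), where C = 1])
  show "(\<lambda>x. exp (\<i> * of_real (p \<bullet> x))) \<in> borel_measurable (lebesgue_on \<Omega>)"
    using assms(1) by (rule continuous_imp_measurable_on_sets_lebesgue[rotated]) (auto intro!: continuous_intros)
qed simp

lemma plane_wave_mult_cancel:
  "plane_wave_mult (- p) (plane_wave_mult p f) = f" "plane_wave_mult p (plane_wave_mult (- p) f) = f"
  unfolding plane_wave_mult_def by (simp_all add: mult.assoc[symmetric] exp_add[symmetric])

lemma L2_inner_plane_wave_mult_left:
  "L2_inner \<Omega> (plane_wave_mult p f) g = L2_inner \<Omega> f (plane_wave_mult (- p) g)"
  unfolding L2_inner_def plane_wave_mult_def by (simp add: exp_cnj mult_ac)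

lemma L2_inner_plane_wave_mult:
  "L2_inner \<Omega> (plane_wave_mult p f) (plane_wave_mult p g) = L2_inner \<Omega> f g"
  by (simp add: L2_inner_plane_wave_mult_left plane_wave_mult_cancel)

lemma weight_nonneg: "0 \<le> weight \<Omega> \<phi> k j p"
  by (simp add: weight_def)

lemma weight_minus: "weight \<Omega> \<phi> k j (- p) = weight \<Omega> \<phi> k j p"
  by (simp add: weight_def)

lemma weight_symmetric: "weight \<Omega> \<phi> k j p = weight \<Omega> \<phi> j k p"
proof -
  have "cmod (L2_inner \<Omega> (plane_wave_mult p (\<phi> j)) (\<phi> k)) =
      cmod (L2_inner \<Omega> (plane_wave_mult (- p) (\<phi> k)) (\<phi> j))" for p
    by (metis L2_inner_plane_wave_mult_left L2_inner_commute complex_mod_cnj)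
  from this[of p] this[of "- p"] show ?thesis unfolding weight_def by simp
qed

lemma orthonormal_basis_L2: "orthonormal_basis \<Omega> \<phi> \<Longrightarrow> \<phi> j \<in> L2 \<Omega>"
  and orthonormal_basis_inner: "orthonormal_basis \<Omega> \<phi> \<Longrightarrow> L2_inner \<Omega> (\<phi> j) (\<phi> j) = 1"
  unfolding orthonormal_basis_def by simp_all

lemma weight_sums_1:
  assumes "\<Omega> \<in> sets lebesgue" "orthonormal_basis \<Omega> \<phi>"
  shows "(\<lambda>k. weight \<Omega> \<phi> k j q) sums 1"
proof -
  have "(\<lambda>k. (cmod (L2_inner \<Omega> (plane_wave_mult p (\<phi> j)) (\<phi> k)))\<^sup>2) sums 1" for p
    using parseval[OF assms(2) L2_plane_wave_mult[OF assms(1) orthonormal_basis_L2[OF assms(2)]], of p j]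
    by (simp add: L2_norm_power2 L2_inner_plane_wave_mult orthonormal_basis_inner[OF assms(2)])
  from sums_mult[OF sums_add[OF this[of "- q"] this[of q]], of "1 / 2"]
  show ?thesis unfolding weight_def by simp
qed

section \<open>The directional derivative\<close>

lemma L2_continuous:
  assumes "bounded_domain \<Omega>" "continuous_on UNIV u"
  shows "u \<in> L2 \<Omega>"
proof -
  have \<Omega>: "bounded \<Omega>" "\<Omega> \<in> sets lebesgue"
    using assms(1) unfolding bounded_domain_def by auto
  have "compact (u ` closure \<Omega>)"
    using \<Omega>(1) assms(2) by (intro compact_continuous_image) (auto intro: continuous_on_subset)
  then have "bounded (u ` closure \<Omega>)" by (rule compact_imp_bounded)
  then obtain C where "\<forall>z \<in> u ` closure \<Omega>. cmod z \<le> C"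
    unfolding bounded_iff by (elim exE)
  then have "cmod (u x) \<le> C" if "x \<in> \<Omega>" for x
    using that closure_subset[of \<Omega>] by auto
  moreover have "u \<in> borel_measurable (lebesgue_on \<Omega>)"
    using continuous_on_subset[OF assms(2)] \<Omega>(2) by (intro continuous_imp_measurable_on_sets_lebesgue) auto
  ultimately show ?thesis
    using L2_bounded_mult[OF L2_const[OF \<Omega>, of 1], of u C] by simp
qed

text \<open>This is the identity \<open>e\<^sub>-\<^sub>p H e\<^sub>p f = H f + |p|\<^sup>2 f - 2 \<i> p \<bullet> \<nabla>f\<close> solved for \<open>p \<bullet> \<nabla>f\<close>.  As a definition it
  yields a square-integrable function before anything is known about derivatives of \<open>f\<close>.\<close>
definition twisted_gradient ::
  "((real^'d \<Rightarrow> complex) \<Rightarrow> (real^'d \<Rightarrow> complex)) \<Rightarrow> real^'d \<Rightarrow> (real^'d \<Rightarrow> complex) \<Rightarrow> (real^'d \<Rightarrow> complex)" where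
  "twisted_gradient H p f = (\<lambda>x. \<i> / 2 *
     (plane_wave_mult (- p) (H (plane_wave_mult p f)) x - H f x - of_real (p \<bullet> p) * f x))"

lemma plane_wave_mult_twisted_gradient:
  "H (plane_wave_mult p f) = plane_wave_mult p (\<lambda>x. H f x + of_real (p \<bullet> p) * f x - 2 * \<i> * twisted_gradient H p f x)"
proof -
  have "(\<lambda>x. H f x + of_real (p \<bullet> p) * f x - 2 * \<i> * twisted_gradient H p f x)
      = plane_wave_mult (- p) (H (plane_wave_mult p f))"
  proof -
    have "2 * \<i> * (\<i> / 2 * z) = - z" for z :: complex by (simp flip: mult.assoc)
    then show ?thesis unfolding twisted_gradient_def by simp
  qed
  then show ?thesis by (simp add: plane_wave_mult_cancel)
qed

lemma twisted_gradient_L2: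
  assumes "\<Omega> \<in> sets lebesgue" "linear_operator \<Omega> D H" "f \<in> D" "plane_wave_mult p f \<in> D"
  shows "twisted_gradient H p f \<in> L2 \<Omega>"
proof -
  have "f \<in> L2 \<Omega>" "H f \<in> L2 \<Omega>" "H (plane_wave_mult p f) \<in> L2 \<Omega>"
    using assms unfolding linear_operator_def by blast+
  then show ?thesis
    unfolding twisted_gradient_def by (intro L2_scale L2_diff L2_plane_wave_mult assms(1))
qed

lemma acts_as_schroedingerD:
  assumes "acts_as_schroedinger \<Omega> V D H" "f \<in> D" "test_function \<Omega> \<psi>"
  shows "(LINT x|lebesgue_on \<Omega>. H f x * \<psi> x) =
    - (\<Sum>i\<in>UNIV. LINT x|lebesgue_on \<Omega>. f x * pderiv_at i (pderiv_at i \<psi>) x)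
      + (LINT x|lebesgue_on \<Omega>. of_real (V x) * f x * \<psi> x)"
  using assms
  unfolding acts_as_schroedinger_def distr_eq_def distr_of_def distr_laplacian_def distr_pderiv_def
  by simp

text \<open>Test the equation for \<open>H (e\<^sub>p f)\<close> against \<open>e\<^sub>-\<^sub>p \<psi>\<close> and subtract the equation for \<open>H f\<close> tested against
  \<open>\<psi>\<close>.  The potential terms agree because the phases cancel, and so do the Laplacians; what is left
  is the gradient term and \<open>|p|\<^sup>2\<close>.\<close>
lemma twisted_gradient_distr:
  fixes \<Omega> :: "(real^'d) set"
  assumes dom: "bounded_domain \<Omega>" and lin: "linear_operator \<Omega> D H"
    and acts: "acts_as_schroedinger \<Omega> V D H"
    and f: "f \<in> D" and pf: "plane_wave_mult p f \<in> D"
  shows "distr_eq \<Omega> (distr_dot_grad p (distr_of \<Omega> f)) (distr_of \<Omega> (twisted_gradient H p f))"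
  unfolding distr_eq_def
proof (intro allI impI)
  fix \<psi> assume \<psi>: "test_function \<Omega> \<psi>"
  have \<Omega>: "\<Omega> \<in> sets lebesgue" using dom unfolding bounded_domain_def by auto
  have L2: "f \<in> L2 \<Omega>" "H f \<in> L2 \<Omega>" "H (plane_wave_mult p f) \<in> L2 \<Omega>"
    using lin f pf unfolding linear_operator_def by blast+
  have int: "integrable (lebesgue_on \<Omega>) (\<lambda>x. g x * u x)" if "g \<in> L2 \<Omega>" "Ck 0 u" for g u
    using that L2_continuous[OF dom] by (intro L2_times_integrable) auto
  have Ck\<psi>: "Ck 0 \<psi>" "Ck 0 (pderiv_at i \<psi>)" "Ck 0 (pderiv_at i (pderiv_at i \<psi>))" "Ck 2 \<psi>" for i
  proof -
    have "Ck (Suc (Suc 0)) \<psi>" using \<psi> by (rule test_function_Ck)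
    then show "Ck 0 (pderiv_at i (pderiv_at i \<psi>))" by simp
  qed (use \<psi> in \<open>blast intro: test_function_Ck test_function_Ck_pderiv\<close>)+
  define \<psi>' where "\<psi>' = (\<lambda>x. exp (\<i> * of_real ((- p) \<bullet> x)) * \<psi> x)"
  have \<psi>': "test_function \<Omega> \<psi>'"
    unfolding \<psi>'_def by (intro test_function_mult Ck_plane_wave \<psi>)
  define I where "I = (\<lambda>u. LINT x|lebesgue_on \<Omega>. f x * u x)"
  have cancel: "exp (\<i> * of_real (p \<bullet> x)) * exp (\<i> * of_real ((- p) \<bullet> x)) = 1" for x
    by (simp add: exp_add[symmetric])
  have second: "(LINT x|lebesgue_on \<Omega>. plane_wave_mult p f x * pderiv_at i (pderiv_at i \<psi>') x)
      = I (pderiv_at i (pderiv_at i \<psi>)) - 2 * \<i> * of_real (p $ i) * I (pderiv_at i \<psi>) - of_real ((p $ i)\<^sup>2) * I \<psi>" for i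
  proof -
    have "plane_wave_mult p f x * pderiv_at i (pderiv_at i \<psi>') x =
      f x * pderiv_at i (pderiv_at i \<psi>) x - 2 * \<i> * of_real (p $ i) * (f x * pderiv_at i \<psi> x)
        - of_real ((p $ i)\<^sup>2) * (f x * \<psi> x)" for x
    proof -
      have "plane_wave_mult p f x * pderiv_at i (pderiv_at i \<psi>') x =
        (exp (\<i> * of_real (p \<bullet> x)) * exp (\<i> * of_real ((- p) \<bullet> x))) * (f x * (pderiv_at i (pderiv_at i \<psi>) x
          + 2 * \<i> * of_real ((- p) $ i) * pderiv_at i \<psi> x - (of_real ((- p) $ i))\<^sup>2 * \<psi> x))"
        unfolding \<psi>'_def pderiv_at_twice_plane_wave_mult[OF Ck\<psi>(4)] plane_wave_mult_def by (simp only: mult_ac)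
      then show ?thesis unfolding cancel by (simp add: algebra_simps)
    qed
    then show ?thesis
      unfolding I_def using int[OF L2(1)] Ck\<psi> by (simp add: Bochner_Integration.integral_diff)
  qed
  have untwisted: "(LINT x|lebesgue_on \<Omega>. H f x * \<psi> x) = - (\<Sum>i\<in>UNIV. I (pderiv_at i (pderiv_at i \<psi>)))
      + (LINT x|lebesgue_on \<Omega>. of_real (V x) * f x * \<psi> x)"
    unfolding I_def by (rule acts_as_schroedingerD[OF acts f \<psi>])
  have "(LINT x|lebesgue_on \<Omega>. plane_wave_mult (- p) (H (plane_wave_mult p f)) x * \<psi> x)
      = (LINT x|lebesgue_on \<Omega>. H (plane_wave_mult p f) x * \<psi>' x)"
    unfolding \<psi>'_def plane_wave_mult_def by (simp add: mult_ac)
  also have "\<dots> = - (\<Sum>i\<in>UNIV. I (pderiv_at i (pderiv_at i \<psi>)) - 2 * \<i> * of_real (p $ i) * I (pderiv_at i \<psi>)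
        - of_real ((p $ i)\<^sup>2) * I \<psi>)
      + (LINT x|lebesgue_on \<Omega>. of_real (V x) * plane_wave_mult p f x * \<psi>' x)"
    unfolding acts_as_schroedingerD[OF acts pf \<psi>'] second ..
  also have "(\<lambda>x. of_real (V x) * plane_wave_mult p f x * \<psi>' x) = (\<lambda>x. of_real (V x) * f x * \<psi> x)"
  proof
    fix x
    have "of_real (V x) * plane_wave_mult p f x * \<psi>' x =
      (exp (\<i> * of_real (p \<bullet> x)) * exp (\<i> * of_real ((- p) \<bullet> x))) * (of_real (V x) * f x * \<psi> x)"
      unfolding \<psi>'_def plane_wave_mult_def by (simp only: mult_ac)
    then show "of_real (V x) * plane_wave_mult p f x * \<psi>' x = of_real (V x) * f x * \<psi> x"
      unfolding cancel by simp
  qed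
  finally have twisted: "(LINT x|lebesgue_on \<Omega>. plane_wave_mult (- p) (H (plane_wave_mult p f)) x * \<psi> x)
      = (LINT x|lebesgue_on \<Omega>. H f x * \<psi> x) + 2 * \<i> * (\<Sum>i\<in>UNIV. of_real (p $ i) * I (pderiv_at i \<psi>))
        + of_real (p \<bullet> p) * I \<psi>"
    unfolding untwisted
    by (simp add: sum_subtractf sum_distrib_left sum_distrib_right inner_vec_def power2_eq_square mult.assoc)
  have "distr_of \<Omega> (twisted_gradient H p f) \<psi> = \<i> / 2 *
      ((LINT x|lebesgue_on \<Omega>. plane_wave_mult (- p) (H (plane_wave_mult p f)) x * \<psi> x)
        - (LINT x|lebesgue_on \<Omega>. H f x * \<psi> x) - of_real (p \<bullet> p) * I \<psi>)"
    unfolding distr_of_def twisted_gradient_def I_def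
    using int[OF L2(1)] int[OF L2(2)] int[OF L2_plane_wave_mult[OF \<Omega> L2(3), of "- p"]] Ck\<psi>(1)
    by (simp add: left_diff_distrib mult.assoc)
  also have "\<dots> = - (\<Sum>i\<in>UNIV. of_real (p $ i) * I (pderiv_at i \<psi>))"
    unfolding twisted by (simp add: algebra_simps)
  also have "\<dots> = distr_dot_grad p (distr_of \<Omega> f) \<psi>"
    unfolding distr_dot_grad_def distr_pderiv_def distr_of_def I_def by (simp add: sum_negf)
  finally show "distr_dot_grad p (distr_of \<Omega> f) \<psi> = distr_of \<Omega> (twisted_gradient H p f) \<psi>" ..
qed

text \<open>Both sides represent the same distribution, the derivative of \<open>f\<close> in direction \<open>- p\<close>.\<close>
lemma twisted_gradient_minus:
  fixes \<Omega> :: "(real^'d) set"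
  assumes dom: "bounded_domain \<Omega>" and lin: "linear_operator \<Omega> D H"
    and acts: "acts_as_schroedinger \<Omega> V D H"
    and f: "f \<in> D" and pf: "plane_wave_mult p f \<in> D" "plane_wave_mult (- p) f \<in> D"
  shows "ae_eq \<Omega> (twisted_gradient H (- p) f) (\<lambda>x. - twisted_gradient H p f x)"
proof -
  have \<Omega>: "open \<Omega>" "bounded \<Omega>" "\<Omega> \<in> sets lebesgue" using dom unfolding bounded_domain_def by auto
  let ?g = "twisted_gradient H p f" and ?g' = "twisted_gradient H (- p) f"
  have g: "?g \<in> L2 \<Omega>" and g': "?g' \<in> L2 \<Omega>"
    using twisted_gradient_L2[OF \<Omega>(3) lin f] pf by auto
  have "AE x in lebesgue_on \<Omega>. ?g x + ?g' x = 0"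
  proof (rule test_functions_separate[OF \<Omega>(1)])
    show "integrable (lebesgue_on \<Omega>) (\<lambda>x. ?g x + ?g' x)"
      using L2_times_integrable[OF L2_add[OF g g'] L2_const[OF \<Omega>(2,3), of 1]] by simp
    fix \<psi> assume \<psi>: "test_function \<Omega> \<psi>"
    have "\<psi> \<in> L2 \<Omega>"
      using \<psi> by (intro L2_continuous dom Ck_imp_continuous test_function_Ck)
    then have "(LINT x|lebesgue_on \<Omega>. (?g x + ?g' x) * \<psi> x) = distr_of \<Omega> ?g \<psi> + distr_of \<Omega> ?g' \<psi>"
      unfolding distr_of_def using g g' by (simp add: distrib_right L2_times_integrable)
    also have "\<dots> = distr_dot_grad p (distr_of \<Omega> f) \<psi> + distr_dot_grad (- p) (distr_of \<Omega> f) \<psi>"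
      using twisted_gradient_distr[OF dom lin acts f] pf \<psi> unfolding distr_eq_def by simp
    also have "\<dots> = 0" unfolding distr_dot_grad_def by (simp add: sum_negf)
    finally show "(LINT x|lebesgue_on \<Omega>. (?g x + ?g' x) * \<psi> x) = 0" .
  qed
  then show ?thesis unfolding ae_eq_def by eventually_elim (simp add: add_eq_0_iff)
qed

section \<open>Moments of the weights\<close>

lemma self_adjoint_symmetric:
  assumes "self_adjoint_operator \<Omega> D H" "f \<in> D" "g \<in> D"
  shows "L2_inner \<Omega> (H f) g = L2_inner \<Omega> f (H g)"
proof -
  have "H g \<in> L2 \<Omega>"
    using assms unfolding self_adjoint_operator_def linear_operator_def by blast
  then have "(g, H g) \<in> operator_graph \<Omega> D H"
    using assms(3) unfolding operator_graph_def ae_eq_def by simp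
  then have "(g, H g) \<in> adjoint_graph \<Omega> D H"
    using assms(1) unfolding self_adjoint_operator_def by simp
  then show ?thesis using assms(2) unfolding adjoint_graph_def by simp
qed

text \<open>The coefficients of \<open>e\<^sub>p F\<close> with \<open>F = |p|\<^sup>2 \<phi>\<^sub>j - 2 \<i> g\<close> are \<open>(\<lambda>\<^sub>k - \<lambda>\<^sub>j) a\<^sub>k\<close>.  Pairing \<open>e\<^sub>p F\<close> with \<open>e\<^sub>p \<phi>\<^sub>j\<close>
  gives the first moment and pairing it with itself gives the second.\<close>
lemma plane_wave_spectral_moments:
  fixes \<Omega> :: "(real^'d) set" and lam :: "nat \<Rightarrow> real"
  assumes \<Omega>: "\<Omega> \<in> sets lebesgue" and sa: "self_adjoint_operator \<Omega> D H"
    and ob: "orthonormal_basis \<Omega> \<phi>"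
    and eig: "\<And>j. \<phi> j \<in> eigenspace \<Omega> D H (of_real (lam j))"
    and pD: "plane_wave_mult p (\<phi> j) \<in> D"
  defines "g \<equiv> twisted_gradient H p (\<phi> j)"
    and "a \<equiv> \<lambda>k. L2_inner \<Omega> (plane_wave_mult p (\<phi> j)) (\<phi> k)"
  shows "(\<lambda>k. (lam k - lam j) * (cmod (a k))\<^sup>2) sums ((norm p)\<^sup>2 + 2 * Im (L2_inner \<Omega> g (\<phi> j)))"
    and "(\<lambda>k. (lam k - lam j)\<^sup>2 * (cmod (a k))\<^sup>2) sums
      (norm p ^ 4 + 4 * (L2_norm \<Omega> g)\<^sup>2 + 4 * (norm p)\<^sup>2 * Im (L2_inner \<Omega> g (\<phi> j)))"
proof -
  have lin: "linear_operator \<Omega> D H" using sa unfolding self_adjoint_operator_def by simp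
  have \<phi>D: "\<phi> k \<in> D" and H\<phi>: "ae_eq \<Omega> (H (\<phi> k)) (\<lambda>x. of_real (lam k) * \<phi> k x)" for k
    using eig[of k] unfolding eigenspace_def by auto
  have \<phi>: "\<phi> k \<in> L2 \<Omega>" for k using ob by (rule orthonormal_basis_L2)
  have H\<phi>L2: "H (\<phi> k) \<in> L2 \<Omega>" for k using lin \<phi>D unfolding linear_operator_def by blast
  have g: "g \<in> L2 \<Omega>" unfolding g_def by (rule twisted_gradient_L2[OF \<Omega> lin \<phi>D pD])
  define F where "F = (\<lambda>x. of_real ((norm p)\<^sup>2) * \<phi> j x + (- 2 * \<i>) * g x)"
  have F: "F \<in> L2 \<Omega>" unfolding F_def by (intro L2_lincomb \<phi> g)
  note pw = L2_plane_wave_mult[OF \<Omega>]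
  have coeff: "L2_inner \<Omega> (plane_wave_mult p F) (\<phi> k) = of_real (lam k - lam j) * a k" for k
  proof -
    have Hp: "H (plane_wave_mult p (\<phi> j)) = plane_wave_mult p (\<lambda>x. H (\<phi> j) x + F x)"
      unfolding plane_wave_mult_twisted_gradient F_def g_def by (simp add: dot_square_norm algebra_simps)
    have "of_real (lam k) * a k = L2_inner \<Omega> (plane_wave_mult p (\<phi> j)) (\<lambda>x. of_real (lam k) * \<phi> k x)"
      by (simp add: a_def L2_inner_scale_right)
    also have "\<dots> = L2_inner \<Omega> (plane_wave_mult p (\<phi> j)) (H (\<phi> k))"
      using H\<phi>[of k] by (intro L2_inner_cong_ae pw \<phi> L2_scale H\<phi>L2) (auto simp: ae_eq_def eq_commute)
    also have "\<dots> = L2_inner \<Omega> (H (plane_wave_mult p (\<phi> j))) (\<phi> k)"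
      by (rule self_adjoint_symmetric[OF sa pD \<phi>D, symmetric])
    also have "\<dots> = L2_inner \<Omega> (\<lambda>x. H (\<phi> j) x + F x) (plane_wave_mult (- p) (\<phi> k))"
      unfolding Hp by (rule L2_inner_plane_wave_mult_left)
    also have "\<dots> = L2_inner \<Omega> (H (\<phi> j)) (plane_wave_mult (- p) (\<phi> k)) + L2_inner \<Omega> F (plane_wave_mult (- p) (\<phi> k))"
      by (intro L2_inner_add_left H\<phi>L2 F pw \<phi>)
    also have "L2_inner \<Omega> (H (\<phi> j)) (plane_wave_mult (- p) (\<phi> k))
        = L2_inner \<Omega> (\<lambda>x. of_real (lam j) * \<phi> j x) (plane_wave_mult (- p) (\<phi> k))"
      using H\<phi>[of j] by (intro L2_inner_cong_ae pw \<phi> L2_scale H\<phi>L2) (auto simp: ae_eq_def)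
    also have "\<dots> = of_real (lam j) * a k"
      by (simp add: a_def L2_inner_scale_left L2_inner_plane_wave_mult_left)
    finally show ?thesis
      by (simp add: L2_inner_plane_wave_mult_left algebra_simps)
  qed
  have norm\<phi>: "(L2_norm \<Omega> (\<phi> j))\<^sup>2 = 1"
    by (simp add: L2_norm_power2 orthonormal_basis_inner[OF ob])
  have a: "L2_inner \<Omega> (plane_wave_mult p (\<phi> j)) (\<phi> k) = a k" for k
    unfolding a_def ..
  have re: "Re (of_real (lam k - lam j) * a k * cnj (a k)) = (lam k - lam j) * (cmod (a k))\<^sup>2" for k
    unfolding mult.assoc complex_norm_square[symmetric] by simp
  have mean: "Re (L2_inner \<Omega> F (\<phi> j)) = (norm p)\<^sup>2 + 2 * Im (L2_inner \<Omega> g (\<phi> j))"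
    unfolding F_def L2_inner_lincomb_left[OF \<phi> g \<phi>] orthonormal_basis_inner[OF ob] by simp
  show "(\<lambda>k. (lam k - lam j) * (cmod (a k))\<^sup>2) sums ((norm p)\<^sup>2 + 2 * Im (L2_inner \<Omega> g (\<phi> j)))"
    using parseval_polarized[OF ob pw[OF F] pw[OF \<phi>], of p p j]
    unfolding coeff L2_inner_plane_wave_mult a re mean .
  have "(cmod (of_real (lam k - lam j) * a k))\<^sup>2 = (lam k - lam j)\<^sup>2 * (cmod (a k))\<^sup>2" for k
    unfolding norm_mult norm_of_real power_mult_distrib by simp
  moreover have "(L2_norm \<Omega> (plane_wave_mult p F))\<^sup>2
      = norm p ^ 4 + 4 * (L2_norm \<Omega> g)\<^sup>2 + 4 * (norm p)\<^sup>2 * Im (L2_inner \<Omega> g (\<phi> j))"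
  proof -
    have "(L2_norm \<Omega> (plane_wave_mult p F))\<^sup>2 = (L2_norm \<Omega> F)\<^sup>2"
      by (simp add: L2_norm_power2 L2_inner_plane_wave_mult)
    also have "\<dots> = ((norm p)\<^sup>2)\<^sup>2 + 4 * (L2_norm \<Omega> g)\<^sup>2
        + 2 * Re (of_real ((norm p)\<^sup>2) * (2 * \<i>) * cnj (L2_inner \<Omega> g (\<phi> j)))"
      unfolding F_def L2_norm_power2_lincomb[OF \<phi> g] norm\<phi> L2_inner_commute[of \<Omega> "\<phi> j" g]
      by (simp add: norm_mult norm_power power_mult_distrib)
    finally show ?thesis by (simp add: power_mult[symmetric])
  qed
  ultimately show "(\<lambda>k. (lam k - lam j)\<^sup>2 * (cmod (a k))\<^sup>2) sums
      (norm p ^ 4 + 4 * (L2_norm \<Omega> g)\<^sup>2 + 4 * (norm p)\<^sup>2 * Im (L2_inner \<Omega> g (\<phi> j)))"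
    using parseval[OF ob pw[OF F], of p] unfolding coeff by simp
qed

text \<open>Averaging over \<open>q\<close> and \<open>- q\<close> removes a contribution \<open>t\<close> that changes sign.\<close>
lemma average_sums:
  fixes c u v :: "nat \<Rightarrow> real"
  assumes "(\<lambda>k. c k * u k) sums (s + - t)" "(\<lambda>k. c k * v k) sums (s + t)"
  shows "(\<lambda>k. c k * (1 / 2 * (u k + v k))) sums s"
proof -
  have "c k * (1 / 2 * (u k + v k)) = 1 / 2 * (c k * u k + c k * v k)" for k
    by (simp add: algebra_simps)
  then show ?thesis using sums_mult[OF sums_add[OF assms], of "1 / 2"] by simp
qed

theorem proposition3p1:
  fixes \<Omega> :: "(real^'d) set"
    and V :: "real^'d \<Rightarrow> real"
    and D :: "(real^'d \<Rightarrow> complex) set"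
    and H :: "(real^'d \<Rightarrow> complex) \<Rightarrow> (real^'d \<Rightarrow> complex)"
    and lam :: "nat \<Rightarrow> real"
    and \<phi> :: "nat \<Rightarrow> real^'d \<Rightarrow> complex"
    and q :: "real^'d"
  assumes "bounded_domain \<Omega>"
    and "V \<in> borel_measurable (lebesgue_on \<Omega>)" and "bounded (V ` \<Omega>)"
    and "self_adjoint_operator \<Omega> D H"
    and "acts_as_schroedinger \<Omega> V D H"
    and "purely_discrete_spectrum \<Omega> D H"
    and "orthonormal_basis \<Omega> \<phi>"
    and "\<And>j. \<phi> j \<in> eigenspace \<Omega> D H (of_real (lam j))"
    and "\<And>f. f \<in> D \<Longrightarrow> plane_wave_mult (- q) f \<in> D"
    and "\<And>f. f \<in> D \<Longrightarrow> plane_wave_mult q f \<in> D"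
  shows "(\<forall>j. (\<lambda>k. weight \<Omega> \<phi> k j q) sums 1)
    \<and> (\<forall>k. (\<lambda>j. weight \<Omega> \<phi> k j q) sums 1)
    \<and> (\<forall>k j. 0 \<le> weight \<Omega> \<phi> k j q \<and> weight \<Omega> \<phi> k j q = weight \<Omega> \<phi> j k q)
    \<and> (\<forall>k j. weight \<Omega> \<phi> k j (- q) = weight \<Omega> \<phi> k j q)
    \<and> (\<forall>j. (\<lambda>k. (lam k - lam j) * weight \<Omega> \<phi> k j q) sums (norm q)\<^sup>2)
    \<and> (\<forall>j. summable (\<lambda>k. lam k * weight \<Omega> \<phi> k j q)
          \<and> lam j = (\<Sum>k. lam k * weight \<Omega> \<phi> k j q) - (norm q)\<^sup>2)
    \<and> (\<forall>j. \<exists>g\<in>L2 \<Omega>. distr_eq \<Omega> (distr_dot_grad q (distr_of \<Omega> (\<phi> j))) (distr_of \<Omega> g)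
          \<and> (\<lambda>k. (lam k - lam j)\<^sup>2 * weight \<Omega> \<phi> k j q) sums (norm q ^ 4 + 4 * (L2_norm \<Omega> g)\<^sup>2))"
proof -
  have dom: "bounded_domain \<Omega>" and sa: "self_adjoint_operator \<Omega> D H"
    and acts: "acts_as_schroedinger \<Omega> V D H" and ob: "orthonormal_basis \<Omega> \<phi>" by fact+
  have \<Omega>: "\<Omega> \<in> sets lebesgue" using dom unfolding bounded_domain_def by auto
  have lin: "linear_operator \<Omega> D H" using sa unfolding self_adjoint_operator_def by simp
  have \<phi>: "\<phi> j \<in> L2 \<Omega>" for j using ob by (rule orthonormal_basis_L2)
  have D: "\<phi> j \<in> D" "plane_wave_mult q (\<phi> j) \<in> D" "plane_wave_mult (- q) (\<phi> j) \<in> D" for j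
    using assms(8)[of j] assms(9,10) unfolding eigenspace_def by auto
  define g where "g j = twisted_gradient H q (\<phi> j)" for j
  have g: "g j \<in> L2 \<Omega>" for j unfolding g_def by (rule twisted_gradient_L2[OF \<Omega> lin D(1,2)])
  have grad: "distr_eq \<Omega> (distr_dot_grad q (distr_of \<Omega> (\<phi> j))) (distr_of \<Omega> (g j))" for j
    unfolding g_def by (rule twisted_gradient_distr[OF dom lin acts D(1,2)])
  have g': "twisted_gradient H (- q) (\<phi> j) \<in> L2 \<Omega>" for j
    by (rule twisted_gradient_L2[OF \<Omega> lin D(1,3)])
  have neg: "ae_eq \<Omega> (twisted_gradient H (- q) (\<phi> j)) (\<lambda>x. - 1 * g j x)" for j
    using twisted_gradient_minus[OF dom lin acts D] unfolding g_def by simp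
  have refl: "ae_eq \<Omega> u u" for u unfolding ae_eq_def by simp
  have inner': "L2_inner \<Omega> (twisted_gradient H (- q) (\<phi> j)) (\<phi> j) = - L2_inner \<Omega> (g j) (\<phi> j)" for j
    using L2_inner_cong_ae[OF neg refl g' L2_scale[OF g] \<phi> \<phi>] unfolding L2_inner_scale_left by simp
  have norm': "(L2_norm \<Omega> (twisted_gradient H (- q) (\<phi> j)))\<^sup>2 = (L2_norm \<Omega> (g j))\<^sup>2" for j
    using L2_inner_cong_ae[OF neg neg g' L2_scale[OF g] g' L2_scale[OF g]]
    unfolding L2_norm_power2 L2_inner_scale_left L2_inner_scale_right by simp
  note plus = plane_wave_spectral_moments[OF \<Omega> sa ob assms(8) D(2), folded g_def]
  note minus = plane_wave_spectral_moments[OF \<Omega> sa ob assms(8) D(3), unfolded inner' norm' norm_minus_cancel]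
  have first: "(\<lambda>k. (lam k - lam j) * weight \<Omega> \<phi> k j q) sums (norm q)\<^sup>2" for j
    unfolding weight_def using minus(1)[of j] plus(1)[of j]
    by (intro average_sums[where t = "2 * Im (L2_inner \<Omega> (g j) (\<phi> j))"]) simp_all
  have second: "(\<lambda>k. (lam k - lam j)\<^sup>2 * weight \<Omega> \<phi> k j q) sums (norm q ^ 4 + 4 * (L2_norm \<Omega> (g j))\<^sup>2)" for j
    unfolding weight_def using minus(2)[of j] plus(2)[of j]
    by (intro average_sums[where t = "4 * (norm q)\<^sup>2 * Im (L2_inner \<Omega> (g j) (\<phi> j))"]) simp_all
  have rows: "(\<lambda>k. weight \<Omega> \<phi> k j q) sums 1" for j
    using \<Omega> ob by (rule weight_sums_1)
  have columns: "(\<lambda>j. weight \<Omega> \<phi> k j q) sums 1" for k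
    using rows[of k] by (subst weight_symmetric)
  have mean: "(\<lambda>k. lam k * weight \<Omega> \<phi> k j q) sums ((norm q)\<^sup>2 + lam j)" for j
    using sums_add[OF first[of j] sums_mult[OF rows[of j], of "lam j"]] by (simp add: algebra_simps)
  have summable: "summable (\<lambda>k. lam k * weight \<Omega> \<phi> k j q)"
    and eigenvalue: "lam j = (\<Sum>k. lam k * weight \<Omega> \<phi> k j q) - (norm q)\<^sup>2" for j
    using sums_summable[OF mean[of j]] sums_unique[OF mean[of j]] by simp_all
  have gradient: "\<exists>g\<in>L2 \<Omega>. distr_eq \<Omega> (distr_dot_grad q (distr_of \<Omega> (\<phi> j))) (distr_of \<Omega> g)
      \<and> (\<lambda>k. (lam k - lam j)\<^sup>2 * weight \<Omega> \<phi> k j q) sums (norm q ^ 4 + 4 * (L2_norm \<Omega> g)\<^sup>2)" for j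
    by (intro bexI[of _ "g j"] conjI grad second g)
  show ?thesis
    by (intro conjI allI rows columns weight_nonneg weight_symmetric weight_minus
        first summable eigenvalue gradient)
qed

end
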